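(* Let $p>q\ge1$ be coprime, $\frac p{p-q}=[b_1,\dots,b_k]$ with $b_i\ge2$. For the Stein filling $W_{p,q}((1,2,\dots,2,1))$ of $(L(p,q),\xi_{can})$, the arrangement of symplectic disks arising from the unbraided wiring diagram $\mathcal W_{\mathbf n}(\mathbf m)$ with $\mathbf n=(1,2,\dots,2,1)$ (length $k$) and $\mathbf m=\mathbf b-\mathbf n$ is combinatorially equivalent to the Scott deformation of a decorated plane curve representing the cyclic quotient singularity with link $L(p,q)$.
   Context: **Continued fractions and blowups.** $[b_1,\dots,b_k]=b_1-\cfrac{1}{b_2-\cfrac{1}{\ddots-\cfrac1{b_k}}}$, $\mathbf b=(b_1,\dots,b_k)$. The $k$-tuple $(1,2,\dots,2,1)$ is understood as $(1,1)$ for $k=2$ and as $(0)$ for $k=1$; it is obtained from $(0)$ by the initial blowup $(0)\to(1,1)$ followed by exterior blowups $(n_1,\dots,n_r)\mapsto(n_1,\dots,n_{r-1},n_r+1,1)$. **$W_{p,q}(\mathbf n)$.** Let $N(\mathbf n)\cong S^1\times S^2$ be the result of surgery on a chain of $k$ unknots in $S^3$ with framings $n_1,\dots,n_k$, and $\mathbf L=\bigcup_iL_i$, where $L_i$ is $b_i-n_i$ parallel meridians of the $i$th unknot with framing $-1$. $W_{p,q}(\mathbf n)$ is obtained from $S^1\times D^3$ by attaching 2-handles along the image of $\mathbf L$ under any diffeomorphism $N(\mathbf n)\to S^1\times S^2$; it is a Stein filling of $(L(p,q),\xi_{can})$, with $\xi_{can}$ the canonical contact structure. **The wiring diagram.**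 An unbraided wiring diagram is a planar diagram of wires (graphs over an interval) with finitely many marked points, at each of which a set of geometrically consecutive wires meet simultaneously (reversing their vertical order) or which is a free point on a single wire, with no other intersections and no braiding. Blowup algorithm: to $(0)$ corresponds one wire $w_1$ without marked points; to $(1,1)$, parallel wires $w_1$ (top, no marked point) and $w_2$ with one free marked point $x_1$; each exterior blowup from $r$ to $r+1$ terms adds a wire $w_{r+1}$ below all others, disjoint from them, with one free marked point $x_r$ to the left of $x_{r-1}$. This gives $\mathcal W_{\mathbf n}$ for $\mathbf n=(1,2,\dots,2,1)$. Twisting algorithm: for $\mathbf m=(m_1,\dots,m_k)$ with $m_i\ge0$, successively for $s=1,\dots,k$ extend the diagram to the left by $m_s$ consecutive marked points $y_s$, at each of which exactly the $s$ wires that are topmost on the right-hand side of the diagram meet simultaneously (for $s=1$, free points on $w_1$). The result is $\mathcal W_{\mathbf n}(\mathbf m)$. **Arrangement and combinatorial equivalence.** $\mathcal W_{\mathbf n}(\mathbf m)$ extends (Plamenevskaya–Starkston) to symplectic graphical disks $\Gamma_1,\dots,\Gamma_k\subset\mathbb C^2$ with marked points: one disk per wire, one marked point per marked point of the diagram, with the same incidences. The incidence matrix has $(i,j)$-entry $1$ if the $j$th marked point lies on the $i$th disk and $0$ otherwise. Two arrangements are combinatorially equivalent if their incidence matrices coincide up to permutation of columns, for suitable enumerations of the disks/branches. **Decorated germ.** A decorated germ is a reduced plane curve germ $\mathcal C=\bigcup_iC_i\subset(\mathbb C^2,0)$ with smooth branches and integers $l=(l_i)$, $l_i>m_i$, where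 $m_i$ is the number of times $C_i$ or its proper transform is blown up in the minimal embedded resolution. It represents the surface singularity obtained by taking the minimal embedded resolution, iteratively blowing up the proper transform of $C_i$ a further $l_i-m_i$ times at the preimage of $0$, and collapsing the exceptional curves not meeting the proper transform of $\mathcal C$. For the cyclic quotient singularity with link $L(p,q)$ and $\frac pq=[a_1,\dots,a_m]$, $a_i\ge 2$: let $G$ be the linear graph with vertices $v_1,\dots,v_m$ weighted $-a_1,\dots,-a_m$; attach $a_1-1$ new vertices of weight $-1$ to $v_1$ and $a_i-2$ to each $v_i$, $i>1$, to get $G'$; attach an arrowhead to each new vertex to get $G''$, an embedded resolution graph of $\mathcal C$ with branches corresponding to arrowheads. The order of intersection of $C_i$ and $C_j$ is the number of vertices on the intersection of the geodesics from the two arrowheads to $v_m$, and $l_i$ is the number of vertices on the geodesic from the $i$th arrowhead to $v_m$. **Picture deformations and the Scott deformation.** A picture deformation of $(\mathcal C,l)$ is a $\delta$-constant one-parameter deformation $\mathcal C^s=\bigcup_iC_i^s$ of $\mathcal C$ (branches deformed separately) with marked points, exactly $l_i$ on $C_i^s$, such that for $s\ne0$ the only singularities are ordinary multiple points, all marked; free marked points on single branches are allowed. The Scott deformation is the canonical picture deformation (corresponding to the Artin smoothing component) whose marked points for $s\ne0$ correspond to the infinitely near points blown up when one takes the minimal embedded resolution of $\mathcal C$ and then iteratively blows up the proper transform of each $C_i$ a further $l_i-m_i$ times at the preimage of $0$, the branches through a marked point being exactly those whose proper transforms pass through the corresponding infinitely near point. *)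

theory Defs
  imports
    "HOL-Complex_Analysis.Complex_Analysis"
    "HOL-Combinatorics.Permutations"
    "Jordan_Normal_Form.Matrix"
begin

no_notation vec_index (infixl "$" 100)

section \<open>Continued fractions and blowups of tuples\<close>

fun hj_cf :: "nat list \<Rightarrow> rat" where
  "hj_cf [] = 0"
| "hj_cf [b] = of_nat b"
| "hj_cf (b # bs) = of_nat b - 1 / hj_cf bs"

definition is_hj_expansion :: "nat list \<Rightarrow> rat \<Rightarrow> bool" where
  "is_hj_expansion bs x \<longleftrightarrow> bs \<noteq> [] \<and> (\<forall>b\<in>set bs. b \<ge> 2) \<and> x = hj_cf bs"

definition exterior_blowup :: "nat list \<Rightarrow> nat list" where
  "exterior_blowup ns = butlast ns @ [last ns + 1, 1]"

fun std_tuple :: "nat \<Rightarrow> nat list" where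
  "std_tuple 0 = []"
| "std_tuple (Suc 0) = [0]"
| "std_tuple (Suc (Suc 0)) = [1, 1]"
| "std_tuple (Suc (Suc (Suc k))) = exterior_blowup (std_tuple (Suc (Suc k)))"

lemma std_tuple_eq: "std_tuple (Suc (Suc k)) = 1 # replicate k 2 @ [1]"
  by (induction k)
     (simp_all add: exterior_blowup_def butlast_append numeral_2_eq_2 flip: replicate_append_same)


section \<open>Wiring diagrams\<close>

text \<open>
  A diagram is recorded by the vertical order (top to bottom) of its wires at the right-hand end
  and by its marked points, listed \<^emph>\<open>from right to left\<close>, each given as the set of the wires
  through it; free points are singletons. Appending to the list of marked points is thus
  extending the diagram to the left.
\<close>

datatype wiring_diagram = Wiring (wires: "nat list") (marks: "nat set list")

fun add_bottom_wire :: "wiring_diagram \<Rightarrow> wiring_diagram" where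
  "add_bottom_wire (Wiring ws ms) =
     (let w = Suc (length ws) in Wiring (ws @ [w]) (ms @ [{w}]))"

text \<open>The initial blowup and the exterior blowups change the diagram by the same rule.\<close>

fun blowup_diagram :: "nat \<Rightarrow> wiring_diagram" where
  "blowup_diagram 0 = Wiring [] []"
| "blowup_diagram (Suc 0) = Wiring [1] []"
| "blowup_diagram (Suc (Suc r)) = add_bottom_wire (blowup_diagram (Suc r))"

fun twist_step :: "nat list \<Rightarrow> nat \<Rightarrow> wiring_diagram \<Rightarrow> wiring_diagram" where
  "twist_step m s (Wiring ws ms) = Wiring ws (ms @ replicate (m ! (s - 1)) (set (take s ws)))"

definition twist :: "nat list \<Rightarrow> wiring_diagram \<Rightarrow> wiring_diagram" where
  "twist m W = fold (twist_step m) [1..<Suc (length m)] W"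

text \<open>
  The geometric meaning of a diagram: wires drawn as graphs of \<open>f w\<close> over \<open>[a,b]\<close>, the marked
  points at abscissae \<open>xs\<close>. Wires meet only at marked points, exactly as prescribed, and reverse
  their order there. That wires meeting at a marked point are geometrically consecutive follows
  from continuity.
\<close>

definition draws ::
    "wiring_diagram \<Rightarrow> real \<Rightarrow> real \<Rightarrow> (nat \<Rightarrow> real \<Rightarrow> real) \<Rightarrow> real list \<Rightarrow> bool" where
  "draws W a b f xs \<longleftrightarrow>
     (\<forall>w\<in>set (wires W). continuous_on {a..b} (f w)) \<and>
     sorted_wrt (\<lambda>v w. f v b > f w b) (wires W) \<and>
     length xs = length (marks W) \<and> sorted_wrt (>) xs \<and> set xs \<subseteq> {a<..<b} \<and>
     (\<forall>v\<in>set (wires W). \<forall>w\<in>set (wires W). v \<noteq> w \<longrightarrow>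
        (\<forall>x\<in>{a..b}. f v x = f w x \<longleftrightarrow>
           (\<exists>j<length xs. x = xs ! j \<and> v \<in> marks W ! j \<and> w \<in> marks W ! j)) \<and>
        (\<forall>j<length xs. v \<in> marks W ! j \<and> w \<in> marks W ! j \<longrightarrow>
           (\<forall>\<^sub>F e in at_right 0.
              f v (xs ! j - e) < f w (xs ! j - e) \<longleftrightarrow> f w (xs ! j + e) < f v (xs ! j + e))))"


section \<open>Arrangements of symplectic graphical disks\<close>

text \<open>\<open>G a b\<close> is the mixed partial derivative of order \<open>a\<close> in \<open>Re z\<close> and \<open>b\<close> in \<open>Im z\<close>.\<close>

definition real_smooth_on :: "complex set \<Rightarrow> (complex \<Rightarrow> complex) \<Rightarrow> bool" where
  "real_smooth_on U f \<longleftrightarrow> (\<exists>G :: nat \<Rightarrow> nat \<Rightarrow> complex \<Rightarrow> complex. G 0 0 = f \<and>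
     (\<forall>a b. \<forall>z\<in>U. (G a b has_derivative
        (\<lambda>h. of_real (Re h) * G (Suc a) b z + of_real (Im h) * G a (Suc b) z)) (at z)))"

definition omega_std :: "complex \<times> complex \<Rightarrow> complex \<times> complex \<Rightarrow> real" where
  "omega_std v w = Im (cnj (fst v) * fst w) + Im (cnj (snd v) * snd w)"

definition graph_disk :: "real \<Rightarrow> (complex \<Rightarrow> complex) \<Rightarrow> (complex \<times> complex) set" where
  "graph_disk \<rho> f = (\<lambda>z. (z, f z)) ` cball 0 \<rho>"

definition symplectic_graph :: "real \<Rightarrow> (complex \<Rightarrow> complex) \<Rightarrow> bool" where
  "symplectic_graph \<rho> f \<longleftrightarrow>
     (\<exists>U. open U \<and> cball 0 \<rho> \<subseteq> U \<and> real_smooth_on U f) \<and>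
     (\<forall>z\<in>cball 0 \<rho>. let D = frechet_derivative f (at z) in
        omega_std (1, D 1) (\<i>, D \<i>) > 0)"

text \<open>
  The arrangement \<open>graph_disk \<rho> (F w)\<close> with marked points \<open>pts\<close> extends the wiring diagram: the
  real parts over the diameter \<open>[-\<rho>,\<rho>]\<close> are the wires of the diagram, and the marked points and
  their incidences are those of the diagram.
\<close>

definition extends_diagram ::
    "wiring_diagram \<Rightarrow> real \<Rightarrow> (nat \<Rightarrow> complex \<Rightarrow> complex) \<Rightarrow> (complex \<times> complex) list \<Rightarrow> bool" where
  "extends_diagram W \<rho> F pts \<longleftrightarrow>
     0 < \<rho> \<and>
     (\<forall>w\<in>set (wires W). symplectic_graph \<rho> (F w)) \<and>
     (\<exists>xs. draws W (-\<rho>) \<rho> (\<lambda>w x. Re (F w (of_real x))) xs \<and>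
        map fst pts = map of_real xs) \<and>
     (\<forall>w\<in>set (wires W). \<forall>j<length pts.
        pts ! j \<in> graph_disk \<rho> (F w) \<longleftrightarrow> w \<in> marks W ! j) \<and>
     (\<forall>v\<in>set (wires W). \<forall>w\<in>set (wires W). v \<noteq> w \<longrightarrow>
        graph_disk \<rho> (F v) \<inter> graph_disk \<rho> (F w) \<subseteq> set pts)"


section \<open>Incidence matrices\<close>

definition incidence_matrix :: "'p set list \<Rightarrow> 'p list \<Rightarrow> int mat" where
  "incidence_matrix Cs ps =
     mat (length Cs) (length ps) (\<lambda>(i, j). if ps ! j \<in> Cs ! i then 1 else 0)"

definition combinatorially_equivalent :: "int mat \<Rightarrow> int mat \<Rightarrow> bool" where
  "combinatorially_equivalent A B \<longleftrightarrow>
     dim_row A = dim_row B \<and> dim_col A = dim_col B \<and>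
     (\<exists>\<sigma> \<tau>. \<sigma> permutes {..<dim_row A} \<and> \<tau> permutes {..<dim_col A} \<and>
        (\<forall>i<dim_row A. \<forall>j<dim_col A. A $$ (i, j) = B $$ (\<sigma> i, \<tau> j)))"


section \<open>Smooth branches and infinitely near points\<close>

text \<open>A smooth branch at the origin of the plane is given by a convergent parametrization.\<close>

type_synonym branch = "complex fps \<times> complex fps"

definition smooth_branch :: "branch \<Rightarrow> bool" where
  "smooth_branch = (\<lambda>(x, y).
     fps_nth x 0 = 0 \<and> fps_nth y 0 = 0 \<and> (fps_nth x 1 \<noteq> 0 \<or> fps_nth y 1 \<noteq> 0) \<and>
     fps_conv_radius x > 0 \<and> fps_conv_radius y > 0)"

text \<open>
  The local equation of the branch \<open>(u,v)\<close>, pulled back to the branch \<open>(x,y)\<close>. The equation is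
  \<open>Y - v(u\<^sup>-\<^sup>1(X)) = 0\<close>, or \<open>X - u(v\<^sup>-\<^sup>1(Y)) = 0\<close> if the tangent is vertical.
\<close>

definition pullback_equation :: "branch \<Rightarrow> branch \<Rightarrow> complex fps" where
  "pullback_equation = (\<lambda>(x, y) (u, v).
     if fps_nth u 1 \<noteq> 0 then y - fps_compose (fps_compose v (fps_inv u)) x
     else x - fps_compose (fps_compose u (fps_inv v)) y)"

definition intersection_mult :: "branch \<Rightarrow> branch \<Rightarrow> nat" where
  "intersection_mult b c = subdegree (pullback_equation b c)"

definition plane_curve_germ :: "branch list \<Rightarrow> bool" where
  "plane_curve_germ C \<longleftrightarrow> C \<noteq> [] \<and> (\<forall>b\<in>set C. smooth_branch b) \<and>
     (\<forall>i<length C. \<forall>j<length C. i \<noteq> j \<longrightarrow> pullback_equation (C ! i) (C ! j) \<noteq> 0)"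

text \<open>
  Blowing up the origin, the point \<open>Some c\<close> of the exceptional curve is the tangent direction
  \<open>[1 : c]\<close>, with coordinates \<open>(x, y/x - c)\<close> centred at it; \<open>None\<close> is the direction \<open>[0 : 1]\<close>, with
  coordinates \<open>(x/y, y)\<close>. An infinitely near point of the origin is the list of directions leading
  to it; the origin is the empty list.
\<close>

type_synonym direction = "complex option"
type_synonym inf_near_point = "direction list"

definition tangent_dir :: "branch \<Rightarrow> direction" where
  "tangent_dir = (\<lambda>(x, y).
     if fps_nth x 1 \<noteq> 0 then Some (fps_nth y 1 / fps_nth x 1) else None)"

definition proper_transform :: "branch \<Rightarrow> branch" where
  "proper_transform = (\<lambda>(x, y).
     if fps_nth x 1 \<noteq> 0 then (x, y / x - fps_const (fps_nth y 1 / fps_nth x 1)) else (x / y, y))"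

fun inf_near :: "nat \<Rightarrow> branch \<Rightarrow> inf_near_point" where
  "inf_near 0 b = []"
| "inf_near (Suc n) b = tangent_dir b # inf_near n (proper_transform b)"

definition on_branch :: "inf_near_point \<Rightarrow> branch \<Rightarrow> bool" where
  "on_branch P b \<longleftrightarrow> P = inf_near (length P) b"

text \<open>The exceptional curve of a blowup, in the coordinates centred at its point \<open>d\<close>.\<close>

definition exc_branch :: "direction \<Rightarrow> branch" where
  "exc_branch d = (case d of Some c \<Rightarrow> (0, fps_X) | None \<Rightarrow> (fps_X, 0))"

text \<open>\<open>on_exc P Q\<close>: the point \<open>Q\<close> lies on the proper transform of the exceptional curve of the
  blowup at \<open>P\<close>.\<close>

definition on_exc :: "inf_near_point \<Rightarrow> inf_near_point \<Rightarrow> bool" where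
  "on_exc P Q \<longleftrightarrow> (\<exists>d R. Q = P @ d # R \<and> on_branch R (exc_branch d))"


section \<open>Composite blowups and resolution graphs\<close>

text \<open>A composition of blowups is encoded by its set of centres; the exceptional curves are
  indexed by the centres.\<close>

definition blowup_set :: "inf_near_point set \<Rightarrow> bool" where
  "blowup_set S \<longleftrightarrow> finite S \<and> (\<forall>P d. P @ [d] \<in> S \<longrightarrow> P \<in> S)"

text \<open>The points over the origin of the blown-up surface.\<close>

definition surface_points :: "inf_near_point set \<Rightarrow> inf_near_point set" where
  "surface_points S = {R. R \<notin> S \<and> (R = [] \<or> butlast R \<in> S)}"

definition self_int :: "inf_near_point set \<Rightarrow> inf_near_point \<Rightarrow> int" where
  "self_int S P = - 1 - int (card {Q\<in>S. on_exc P Q})"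

definition exc_adjacent :: "inf_near_point set \<Rightarrow> inf_near_point \<Rightarrow> inf_near_point \<Rightarrow> bool" where
  "exc_adjacent S P Q \<longleftrightarrow> P \<noteq> Q \<and> (\<exists>R\<in>surface_points S. on_exc P R \<and> on_exc Q R)"

definition exc_meets_branch :: "inf_near_point set \<Rightarrow> inf_near_point \<Rightarrow> branch \<Rightarrow> bool" where
  "exc_meets_branch S P b \<longleftrightarrow> (\<exists>R\<in>surface_points S. on_exc P R \<and> on_branch R b)"

text \<open>
  The proper transforms of the branches are separated, and each crosses at most one exceptional
  curve, transversally. Exceptional curves always have normal crossings among themselves.
\<close>

definition embedded_resolution :: "branch list \<Rightarrow> inf_near_point set \<Rightarrow> bool" where
  "embedded_resolution C S \<longleftrightarrow> blowup_set S \<and>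
     (\<forall>R\<in>surface_points S. \<forall>i<length C. on_branch R (C ! i) \<longrightarrow>
        (\<forall>j<length C. on_branch R (C ! j) \<longrightarrow> i = j) \<and>
        card {P\<in>S. on_exc P R} \<le> 1 \<and>
        (\<forall>P\<in>S. \<not> on_exc P (inf_near (Suc (length R)) (C ! i))))"

definition min_resolution :: "branch list \<Rightarrow> inf_near_point set" where
  "min_resolution C = (LEAST S. embedded_resolution C S)"

definition min_blowups :: "branch list \<Rightarrow> nat \<Rightarrow> nat" where
  "min_blowups C i = card {n. inf_near n (C ! i) \<in> min_resolution C}"


section \<open>Decorated germs\<close>

definition decorated_germ :: "branch list \<Rightarrow> nat list \<Rightarrow> bool" where
  "decorated_germ C l \<longleftrightarrow> plane_curve_germ C \<and> length l = length C \<and>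
     (\<forall>i<length C. min_blowups C i < l ! i)"

definition blown_up_points :: "branch list \<Rightarrow> nat list \<Rightarrow> inf_near_point set" where
  "blown_up_points C l = min_resolution C \<union>
     {inf_near n (C ! i) | i n. i < length C \<and> min_blowups C i \<le> n \<and> n < l ! i}"

text \<open>
  The exceptional curves that do not meet the proper transform of the curve form a chain with
  self-intersections \<open>-a\<^sub>1, \<dots>, -a\<^sub>m\<close>, where \<open>p/q = [a\<^sub>1, \<dots>, a\<^sub>m]\<close>. This is the
  resolution graph of the cyclic quotient singularity with link \<open>L(p,q)\<close>, and that singularity is
  determined by its resolution graph.
\<close>

definition represents_cyclic_quotient :: "nat \<Rightarrow> nat \<Rightarrow> branch list \<Rightarrow> nat list \<Rightarrow> bool" where
  "represents_cyclic_quotient p q C l \<longleftrightarrow>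
     (let S = blown_up_points C l in
      \<exists>a v. is_hj_expansion a (of_nat p / of_nat q) \<and>
        bij_betw v {..<length a} {P\<in>S. \<forall>b\<in>set C. \<not> exc_meets_branch S P b} \<and>
        (\<forall>i<length a. self_int S (v i) = - int (a ! i)) \<and>
        (\<forall>i<length a. \<forall>j<length a.
           exc_adjacent S (v i) (v j) \<longleftrightarrow> i = Suc j \<or> j = Suc i))"

text \<open>
  The graph obtained from the chain \<open>a\<close> by attaching new vertices of weight \<open>-1\<close>: \<open>Inl i\<close> is the
  vertex of the chain with index \<open>i\<close> (counted from 0) and \<open>Inr (i, c)\<close> are the new vertices
  attached to it. Each new vertex carries one arrowhead, so \<open>(i, c)\<close> also names the arrowhead.
\<close>

definition new_vertices :: "nat list \<Rightarrow> (nat \<times> nat) set" where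
  "new_vertices a =
     {(i, c). i < length a \<and> c < (if i = 0 then a ! 0 - 1 else a ! i - 2)}"

definition graph_vertices :: "nat list \<Rightarrow> (nat + nat \<times> nat) set" where
  "graph_vertices a = Inl ` {..<length a} \<union> Inr ` new_vertices a"

fun graph_weight :: "nat list \<Rightarrow> nat + nat \<times> nat \<Rightarrow> int" where
  "graph_weight a (Inl i) = - int (a ! i)"
| "graph_weight a (Inr _) = - 1"

fun graph_adjacent :: "nat + nat \<times> nat \<Rightarrow> nat + nat \<times> nat \<Rightarrow> bool" where
  "graph_adjacent (Inl i) (Inl j) \<longleftrightarrow> i = Suc j \<or> j = Suc i"
| "graph_adjacent (Inl i) (Inr (j, c)) \<longleftrightarrow> i = j"
| "graph_adjacent (Inr (i, c)) (Inl j) \<longleftrightarrow> i = j"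
| "graph_adjacent (Inr _) (Inr _) \<longleftrightarrow> False"

text \<open>The vertices on the geodesic from an arrowhead to the last vertex of the chain.\<close>

fun geodesic :: "nat list \<Rightarrow> nat \<times> nat \<Rightarrow> (nat + nat \<times> nat) set" where
  "geodesic a (i, c) = insert (Inr (i, c)) (Inl ` {i..<length a})"

text \<open>The decorated germ constructed from the continued fraction of \<open>p/q\<close>.\<close>

definition cyclic_quotient_germ :: "nat \<Rightarrow> nat \<Rightarrow> branch list \<Rightarrow> nat list \<Rightarrow> bool" where
  "cyclic_quotient_germ p q C l \<longleftrightarrow>
     (let S = blown_up_points C l in
      \<exists>a \<phi> \<psi>. is_hj_expansion a (of_nat p / of_nat q) \<and>
        bij_betw \<phi> (graph_vertices a) S \<and>
        bij_betw \<psi> {..<length C} (new_vertices a) \<and>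
        (\<forall>u\<in>graph_vertices a. self_int S (\<phi> u) = graph_weight a u) \<and>
        (\<forall>u\<in>graph_vertices a. \<forall>u'\<in>graph_vertices a.
           exc_adjacent S (\<phi> u) (\<phi> u') \<longleftrightarrow> graph_adjacent u u') \<and>
        (\<forall>u\<in>graph_vertices a. \<forall>i<length C.
           exc_meets_branch S (\<phi> u) (C ! i) \<longleftrightarrow> u = Inr (\<psi> i)) \<and>
        (\<forall>i<length C. l ! i = card (geodesic a (\<psi> i))) \<and>
        (\<forall>i<length C. \<forall>j<length C. i \<noteq> j \<longrightarrow>
           intersection_mult (C ! i) (C ! j) = card (geodesic a (\<psi> i) \<inter> geodesic a (\<psi> j))))"


section \<open>Picture deformations and the Scott deformation\<close>

definition holomorphic_germ2 :: "(complex \<Rightarrow> complex \<Rightarrow> complex) \<Rightarrow> bool" where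
  "holomorphic_germ2 f \<longleftrightarrow> (\<exists>U :: (complex \<times> complex) set. open U \<and> (0, 0) \<in> U \<and>
     (\<forall>z\<in>U. \<exists>a b. ((\<lambda>(s, t). f s t) has_derivative (\<lambda>(ds, dt). a * ds + b * dt)) (at z)))"

text \<open>The germ at parameter \<open>t0\<close> of a parametrized curve, translated to the origin.\<close>

definition branch_at :: "(complex \<Rightarrow> complex \<times> complex) \<Rightarrow> complex \<Rightarrow> branch" where
  "branch_at \<gamma> t0 =
     (fps_expansion (\<lambda>t. fst (\<gamma> t)) t0 - fps_const (fst (\<gamma> t0)),
      fps_expansion (\<lambda>t. snd (\<gamma> t)) t0 - fps_const (snd (\<gamma> t0)))"

text \<open>The total delta invariant of a union of \<open>k\<close> smooth parametrized curves over \<open>ball 0 r\<close>: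
  each singular point contributes the sum of the pairwise intersection multiplicities of the
  branches through it.\<close>

definition total_delta :: "nat \<Rightarrow> (nat \<Rightarrow> complex \<Rightarrow> complex \<times> complex) \<Rightarrow> real \<Rightarrow> nat" where
  "total_delta k \<gamma> r =
     (\<Sum>(i, j)\<in>{(i, j). i < j \<and> j < k}.
        \<Sum>(t, u)\<in>{(t, u). t \<in> ball 0 r \<and> u \<in> ball 0 r \<and> \<gamma> i t = \<gamma> j u}.
          intersection_mult (branch_at (\<gamma> i) t) (branch_at (\<gamma> j) u))"

definition fibre_branch ::
    "(nat \<Rightarrow> complex \<Rightarrow> complex \<Rightarrow> complex \<times> complex) \<Rightarrow> real \<Rightarrow> complex \<Rightarrow> nat \<Rightarrow> (complex \<times> complex) set"
  where "fibre_branch \<Gamma> r s i = \<Gamma> i s ` ball 0 r"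

text \<open>
  \<open>\<Gamma> i s\<close> parametrizes the deformed branch \<open>C\<^sub>i\<^sup>s\<close> and \<open>M s\<close> is the set of marked points of the
  fibre over \<open>s\<close>. Every deformation of a smooth branch is a deformation of its parametrization.
  The statements about fibres hold in every sufficiently small neighbourhood (radius \<open>r\<close>), for
  \<open>s \<noteq> 0\<close> small depending on \<open>r\<close>; in particular the marked points tend to the origin. On each branch
  they form the zeros of a holomorphic family \<open>h\<close> specializing to \<open>l\<^sub>i\<close> times the origin.
\<close>

definition picture_deformation ::
    "branch list \<Rightarrow> nat list \<Rightarrow> (nat \<Rightarrow> complex \<Rightarrow> complex \<Rightarrow> complex \<times> complex) \<Rightarrow>
     (complex \<Rightarrow> (complex \<times> complex) set) \<Rightarrow> bool" where
  "picture_deformation C l \<Gamma> M \<longleftrightarrow>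
     (\<forall>i<length C.
        holomorphic_germ2 (\<lambda>s t. fst (\<Gamma> i s t)) \<and> holomorphic_germ2 (\<lambda>s t. snd (\<Gamma> i s t)) \<and>
        \<Gamma> i 0 0 = (0, 0) \<and> branch_at (\<Gamma> i 0) 0 = C ! i \<and>
        (\<exists>h. holomorphic_germ2 h \<and>
           fps_expansion (h 0) 0 \<noteq> 0 \<and> subdegree (fps_expansion (h 0) 0) = l ! i \<and>
           (\<forall>\<^sub>F r in at_right 0. \<forall>\<^sub>F s in at 0.
              \<forall>t\<in>ball 0 r. \<Gamma> i s t \<in> M s \<longleftrightarrow> h s t = 0))) \<and>
     (\<forall>\<^sub>F r in at_right 0. \<forall>\<^sub>F s in at 0.
        (\<forall>i<length C. inj_on (\<Gamma> i s) (ball 0 r) \<and>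
           (\<forall>t\<in>ball 0 r. smooth_branch (branch_at (\<Gamma> i s) t))) \<and>
        (\<forall>i<length C. \<forall>j<length C. \<forall>t\<in>ball 0 r. \<forall>u\<in>ball 0 r.
           i \<noteq> j \<and> \<Gamma> i s t = \<Gamma> j s u \<longrightarrow>
             tangent_dir (branch_at (\<Gamma> i s) t) \<noteq> tangent_dir (branch_at (\<Gamma> j s) u) \<and>
             \<Gamma> i s t \<in> M s) \<and>
        M s \<subseteq> (\<Union>i<length C. fibre_branch \<Gamma> r s i) \<and>
        (\<forall>i<length C. finite (M s \<inter> fibre_branch \<Gamma> r s i) \<and>
           card (M s \<inter> fibre_branch \<Gamma> r s i) = l ! i) \<and>
        total_delta (length C) (\<lambda>i. \<Gamma> i s) r = total_delta (length C) (\<lambda>i. \<Gamma> i 0) r)"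

definition scott_deformation ::
    "branch list \<Rightarrow> nat list \<Rightarrow> (nat \<Rightarrow> complex \<Rightarrow> complex \<Rightarrow> complex \<times> complex) \<Rightarrow>
     (complex \<Rightarrow> (complex \<times> complex) set) \<Rightarrow> bool" where
  "scott_deformation C l \<Gamma> M \<longleftrightarrow> picture_deformation C l \<Gamma> M \<and>
     (\<forall>\<^sub>F r in at_right 0. \<forall>\<^sub>F s in at 0.
        \<exists>\<beta>. bij_betw \<beta> (blown_up_points C l) (M s) \<and>
          (\<forall>P\<in>blown_up_points C l. \<forall>i<length C.
             \<beta> P \<in> fibre_branch \<Gamma> r s i \<longleftrightarrow> on_branch P (C ! i)))"

end

theory Submission
  imports Defs
begin

text \<open>
  Everything is compared with one explicit curve. Number the entries of \<open>b\<close> from \<open>0\<close> and put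
  \<open>T i = 1 + (\<Sum>s\<ge>i. b s - 2)\<close>, a nonincreasing sequence of positive numbers (\<open>levels\<close>). The germ
  has the branches \<open>Y = (i + 1) X\<^bsup>T i\<^esup>\<close> for \<open>i < k\<close>, with decoration \<open>T i + 1\<close>.

  The first \<open>T i\<close> infinitely near points of branch \<open>i\<close>, the origin included, lie on a common
  \<^emph>\<open>spine\<close>, which has \<open>T 0\<close> points in all; the next one is a \<^emph>\<open>leaf\<close>, which lies on no other branch.
  The minimal embedded resolution blows up the points that lie on at least two branches, and the
  decoration makes the blown-up points the whole spine and one leaf for each branch. The
  exceptional curves form the corresponding tree: the spine gives a chain, a leaf gives a curve of
  self-intersection \<open>-1\<close> that is met by its branch, and the self-intersection of a spine curve is
  determined by the number of leaves attached to it, that is, by how often a value occurs in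
  \<open>T\<close>. Reading these numbers off as a continued fraction inverts Riemenschneider's point diagram,
  so the chain belongs to \<open>p / q\<close> when \<open>b\<close> belongs to \<open>p / (p - q)\<close>
  (\<open>riemenschneider_duality\<close>, \<open>cyclic_quotient_germ_germ\<close>).

  A Scott deformation of this germ exists because the points of the spine can be moved apart: let
  \<open>X\<^bsup>T i\<^esup>\<close> become the product of the \<open>X - n s\<close> for \<open>1 \<le> n \<le> T i\<close>. Near the origin two branches then
  meet only in the points \<open>(n s, 0)\<close> that both of them contain, and they do so transversally
  (\<open>scott_deformation_family\<close>).

  In every Scott deformation the marked points have the incidences of the blown-up infinitely near
  points, so the comparison with the diagram is a matter of counting. The spine point with number \<open>n\<close> lies on the branches with \<open>T i > n\<close>. By monotonicity these are the
  branches \<open>0, \<dots>, j\<close> for some \<open>j\<close>, and a given \<open>j\<close> occurs \<open>T j - T (j + 1)\<close> times, where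
  \<open>T k\<close> counts as \<open>0\<close>. This is the number of twists on the top \<open>j + 1\<close> wires, except that there is
  one more free point on the first wire. That point and the free points from the blowups account
  for the leaves. Hence the two incidence matrices have the same multiset of columns
  (\<open>mset_marks_diagram\<close>).
\<close>

section \<open>Infinitely near points of graphs\<close>

lemma fps_div_X:
  fixes y :: "complex fps"
  shows "y / fps_X = fps_shift 1 y"
  using fps_shift_altdef[of 1 y] by simp

lemma proper_transform_graph:
  assumes "fps_nth y 0 = 0"
  shows "proper_transform (fps_X, y) = (fps_X, fps_shift 1 y - fps_const (fps_nth y 1))"
  by (simp add: proper_transform_def fps_div_X)

text \<open>
  Each blowup divides \<open>y\<close> by \<open>X\<close> and removes the constant term, so the directions are the
  successive coefficients of \<open>y\<close>.
\<close>

lemma inf_near_graph: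
  assumes "fps_nth y 0 = 0"
  shows "inf_near n (fps_X, y) = map (\<lambda>i. Some (fps_nth y (Suc i))) [0..<n]"
  using assms
proof (induction n arbitrary: y)
  case (Suc n)
  let ?y = "fps_shift 1 y - fps_const (fps_nth y 1)"
  have coeff: "fps_nth ?y (Suc i) = fps_nth y (Suc (Suc i))" for i by simp
  have "inf_near (Suc n) (fps_X, y) = Some (fps_nth y 1) # inf_near n (fps_X, ?y)"
    by (simp add: proper_transform_graph[OF Suc.prems] tangent_dir_def del: One_nat_def)
  also have "inf_near n (fps_X, ?y) = map (\<lambda>i. Some (fps_nth y (Suc (Suc i)))) [0..<n]"
    using Suc.IH[of ?y] coeff by simp
  also have "Some (fps_nth y 1) # \<dots> = map (\<lambda>i. Some (fps_nth y (Suc i))) [0..<Suc n]"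
    by (simp add: map_Suc_upt[symmetric] upt_conv_Cons comp_def del: map_Suc_upt upt_Suc)
  finally show ?case .
qed simp

lemma length_inf_near [simp]: "length (inf_near n b) = n"
  by (induction n arbitrary: b) simp_all

lemma inf_near_exc_Some: "inf_near n (0, fps_X) = replicate n None"
  by (induction n) (simp_all add: tangent_dir_def proper_transform_def)

text \<open>
  The strict transform of the exceptional curve of a blowup leaves every chart \<open>Some c\<close> in the
  direction \<open>None\<close>. Among points whose directions are all of the form \<open>Some c\<close>, the exceptional curve
  of \<open>P\<close> therefore passes only through the points in the first neighbourhood of \<open>P\<close>.
\<close>

lemma on_exc_affine:
  assumes "None \<notin> set Q"
  shows "on_exc P Q \<longleftrightarrow> Q \<noteq> [] \<and> P = butlast Q"
proof
  assume "on_exc P Q"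
  then obtain d R where Q: "Q = P @ d # R" and R: "on_branch R (exc_branch d)"
    by (auto simp: on_exc_def)
  obtain c where d: "d = Some c" using Q assms by (cases d) auto
  have "R = replicate (length R) None"
    using R by (simp add: on_branch_def d exc_branch_def inf_near_exc_Some)
  moreover have "None \<notin> set R" using Q assms by simp
  ultimately have "R = []" by (metis in_set_replicate length_0_conv)
  then show "Q \<noteq> [] \<and> P = butlast Q" using Q by simp
next
  assume "Q \<noteq> [] \<and> P = butlast Q"
  then have "Q = P @ [last Q]" by simp
  then have "Q = P @ last Q # []" using \<open>Q \<noteq> [] \<and> P = butlast Q\<close> by simp
  moreover have "on_branch [] (exc_branch (last Q))" by (simp add: on_branch_def)
  ultimately show "on_exc P Q" unfolding on_exc_def by blast
qed

text \<open>
  A point of the surface over affine centres has at most one direction \<open>None\<close>, namely the last one.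
  Thus only the exceptional curve of its predecessor and, if the last direction is \<open>None\<close>, that of
  the predecessor before can pass through it.
\<close>

lemma on_exc_surface_point:
  assumes "R \<in> surface_points S" and aff: "\<And>P. P \<in> S \<Longrightarrow> None \<notin> set P" and "on_exc P R"
  shows "R \<noteq> [] \<and> (P = butlast R \<or> butlast R \<noteq> [] \<and> P = butlast (butlast R))"
proof -
  obtain d A where R: "R = P @ d # A" and A: "on_branch A (exc_branch d)"
    using assms(3) by (auto simp: on_exc_def)
  have RS: "None \<notin> set (butlast R)" using assms(1) aff R by (auto simp: surface_points_def)
  show ?thesis
  proof (cases A rule: rev_cases)
    case Nil
    then show ?thesis using R by simp
  next
    case (snoc A0 x)
    then have bl: "butlast R = P @ d # A0" by (simp add: R butlast_append)
    then obtain c where d: "d = Some c" using RS by (cases d) auto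
    have "A = replicate (length A) None"
      using A by (simp add: on_branch_def d exc_branch_def inf_near_exc_Some)
    then have "set A \<subseteq> {None}" by (metis set_replicate_conv_if empty_subsetI subset_refl)
    moreover have "None \<notin> set A0" using RS bl by simp
    ultimately have "A0 = []" using snoc by (cases A0) auto
    then show ?thesis using bl R by simp
  qed
qed

text \<open>
  The dual graph of the exceptional curves over affine centres is the tree of the centres.
\<close>

lemma exc_adjacent_affine:
  assumes aff: "\<And>P. P \<in> S \<Longrightarrow> None \<notin> set P" and P: "P \<in> S" and Q: "Q \<in> S"
  shows "exc_adjacent S P Q \<longleftrightarrow> Q \<noteq> [] \<and> P = butlast Q \<or> P \<noteq> [] \<and> Q = butlast P"
proof
  assume "exc_adjacent S P Q"
  then obtain R where R: "P \<noteq> Q" "R \<in> surface_points S" "on_exc P R" "on_exc Q R"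
    unfolding exc_adjacent_def by blast
  have "P = butlast R \<or> butlast R \<noteq> [] \<and> P = butlast (butlast R)"
    "Q = butlast R \<or> butlast R \<noteq> [] \<and> Q = butlast (butlast R)"
    using on_exc_surface_point[OF R(2) aff R(3)] on_exc_surface_point[OF R(2) aff R(4)] by blast+
  then show "Q \<noteq> [] \<and> P = butlast Q \<or> P \<noteq> [] \<and> Q = butlast P"
    using R(1) by auto
next
  \<comment> \<open>The point where the curve of a point meets the curve of its predecessor is in the
    direction \<open>None\<close>.\<close>
  have child: "exc_adjacent S (butlast Q) Q \<and> exc_adjacent S Q (butlast Q)"
    if "Q \<in> S" "Q \<noteq> []" for Q
  proof -
    define A where "A = butlast Q"
    define c where "c = last Q"
    have Q: "Q = A @ [c]" using that by (simp add: A_def c_def)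
    obtain e where "c = Some e" using aff[OF \<open>Q \<in> S\<close>] Q by (cases c) auto
    then have A: "on_branch [None] (exc_branch c)"
      by (simp add: on_branch_def exc_branch_def tangent_dir_def)
    have "Q @ [None] \<in> surface_points S"
      using that aff[of "Q @ [None]"] by (auto simp: surface_points_def)
    moreover have "on_exc A (Q @ [None])" using Q A by (auto simp: on_exc_def)
    moreover have "on_exc Q (Q @ [None])" by (auto simp: on_exc_def on_branch_def)
    moreover have "A \<noteq> Q" using Q by simp
    ultimately show ?thesis unfolding exc_adjacent_def A_def by metis
  qed
  assume "Q \<noteq> [] \<and> P = butlast Q \<or> P \<noteq> [] \<and> Q = butlast P"
  then show "exc_adjacent S P Q" using child P Q by blast
qed

lemma on_branch_butlast: "on_branch P b \<Longrightarrow> on_branch (butlast P) b"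
proof -
  have suc: "butlast (inf_near (Suc n) b) = inf_near n b" for n b
  proof (induction n arbitrary: b)
    case (Suc n)
    then show ?case by (simp only: inf_near.simps) simp
  qed simp
  have "butlast (inf_near n b) = inf_near (n - 1) b" for n b
    using suc by (cases n) simp_all
  then show "on_branch P b \<Longrightarrow> on_branch (butlast P) b"
    unfolding on_branch_def by (metis length_butlast)
qed

lemma on_branch_take: "on_branch P b \<Longrightarrow> on_branch (take n P) b"
proof (induction "length P - n" arbitrary: n)
  case 0
  then show ?case by simp
next
  case (Suc d)
  then have "on_branch (take (Suc n) P) b" by simp
  moreover have "butlast (take (Suc n) P) = take n P" using Suc(2) by (subst butlast_take) auto
  ultimately show ?case using on_branch_butlast[of "take (Suc n) P" b] by simp
qed

text \<open>
  If exactly the first \<open>L\<close> infinitely near points of a branch are blown up, its proper transform lies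
  over the next point and meets only the last exceptional curve.
\<close>

lemma exc_meets_graph:
  assumes aff: "None \<notin> set (inf_near L b)" and "0 < L"
    and S: "\<And>n. inf_near n b \<in> S \<longleftrightarrow> n < L"
  shows "exc_meets_branch S P b \<longleftrightarrow> P = inf_near (L - 1) b"
proof -
  have bl: "butlast (inf_near n b) = inf_near (n - 1) b" for n
    using on_branch_butlast[of "inf_near n b" b] by (simp add: on_branch_def)
  have surf: "R \<in> surface_points S \<and> on_branch R b \<longleftrightarrow> R = inf_near L b" for R
  proof
    assume R: "R \<in> surface_points S \<and> on_branch R b"
    define n where "n = length R"
    have Rn: "R = inf_near n b" using R by (simp add: on_branch_def n_def)
    have "\<not> n < L" using R S[of n] Rn by (simp add: surface_points_def)
    then have "R \<noteq> []" using \<open>0 < L\<close> n_def by auto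
    then have "inf_near (n - 1) b \<in> S" using R bl[of n] Rn by (simp add: surface_points_def)
    then have "n = L" using S \<open>\<not> n < L\<close> by simp
    then show "R = inf_near L b" using Rn by simp
  next
    assume "R = inf_near L b"
    then show "R \<in> surface_points S \<and> on_branch R b"
      unfolding surface_points_def on_branch_def mem_Collect_eq length_inf_near bl S
      using \<open>0 < L\<close> S[of L] \<open>R = inf_near L b\<close> bl[of L] S[of "L - 1"] by auto
  qed
  have "exc_meets_branch S P b \<longleftrightarrow>
      (\<exists>R. (R \<in> surface_points S \<and> on_branch R b) \<and> on_exc P R)"
    unfolding exc_meets_branch_def by auto
  also have "\<dots> \<longleftrightarrow> on_exc P (inf_near L b)"
    unfolding surf by simp
  also have "\<dots> \<longleftrightarrow> P = inf_near (L - 1) b"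
  proof -
    have "inf_near L b \<noteq> []" using \<open>0 < L\<close> length_inf_near[of L b] by fastforce
    then show ?thesis unfolding on_exc_affine[OF aff] bl by simp
  qed
  finally show ?thesis .
qed

section \<open>The minimal embedded resolution\<close>

definition multiple_points :: "branch list \<Rightarrow> inf_near_point set" where
  "multiple_points C = {P. \<exists>i<length C. \<exists>j<length C. i \<noteq> j \<and> on_branch P (C ! i) \<and> on_branch P (C ! j)}"

text \<open>
  If a point on two branches is not a centre, its first prefix that is not a centre is a point of
  the surface where the two branches are not separated.
\<close>

lemma multiple_points_subset_resolution:
  assumes "embedded_resolution C S"
  shows "multiple_points C \<subseteq> S"
proof
  fix P assume "P \<in> multiple_points C"
  then obtain i j where ij: "i < length C" "j < length C" "i \<noteq> j"
    "on_branch P (C ! i)" "on_branch P (C ! j)" by (auto simp: multiple_points_def)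
  show "P \<in> S"
  proof (rule ccontr)
    assume "P \<notin> S"
    define n where "n = (LEAST n. take n P \<notin> S)"
    have n: "take n P \<notin> S" unfolding n_def
      by (rule LeastI[of _ "length P"]) (simp add: \<open>P \<notin> S\<close>)
    have "n \<le> length P" unfolding n_def by (rule Least_le) (simp add: \<open>P \<notin> S\<close>)
    have less: "take m P \<in> S" if "m < n" for m
      using not_less_Least[of m "\<lambda>n. take n P \<notin> S"] that by (auto simp: n_def)
    have "take n P \<in> surface_points S"
      using n less[of "n - 1"] \<open>n \<le> length P\<close> by (cases n) (auto simp: surface_points_def butlast_take)
    then show False using assms ij on_branch_take unfolding embedded_resolution_def by meson
  qed
qed

lemma min_resolution_eq_multiple_points:
  assumes "embedded_resolution C (multiple_points C)"
  shows "min_resolution C = multiple_points C"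
  unfolding min_resolution_def
  by (rule Least_equality) (auto intro: assms dest: multiple_points_subset_resolution)

lemma inf_near_take:
  assumes "m \<le> n"
  shows "take m (inf_near n b) = inf_near m b"
  using on_branch_take[of "inf_near n b" b m] assms by (simp add: on_branch_def min_def)

text \<open>
  The last hypothesis says that every branch leaves all others before its last blown-up point.
\<close>

context
  fixes C :: "branch list" and l :: "nat list"
  assumes pos: "\<And>i. i < length C \<Longrightarrow> 0 < l ! i"
    and bound: "\<And>i n. i < length C \<Longrightarrow> inf_near n (C ! i) \<in> multiple_points C \<Longrightarrow> Suc n < l ! i"
begin

lemma embedded_resolution_multiple_points:
  assumes graph: "\<And>b. b \<in> set C \<Longrightarrow> \<exists>y. b = (fps_X, y) \<and> fps_nth y 0 = 0"
  shows "embedded_resolution C (multiple_points C)"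
proof -
  let ?M = "multiple_points C"
  have aff: "None \<notin> set P" if on: "on_branch P (C ! i)" and i: "i < length C" for P i
  proof -
    obtain y where y: "C ! i = (fps_X, y)" "fps_nth y 0 = 0"
      using graph[OF nth_mem[OF i]] by blast
    have "P = inf_near (length P) (fps_X, y)" using on y(1) by (simp add: on_branch_def)
    also have "\<dots> = map (\<lambda>i. Some (fps_nth y (Suc i))) [0..<length P]" by (rule inf_near_graph[OF y(2)])
    finally show ?thesis by (metis (no_types, lifting) ex_map_conv option.distinct(1))
  qed
  have "P \<in> (\<Union>i<length C. (\<lambda>n. inf_near n (C ! i)) ` {..<l ! i})" if "P \<in> ?M" for P
  proof -
    obtain i where i: "i < length C" "on_branch P (C ! i)" using \<open>P \<in> ?M\<close>
      unfolding multiple_points_def by blast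
    then have P: "P = inf_near (length P) (C ! i)" by (simp add: on_branch_def)
    then have "length P < l ! i" using bound[OF i(1), of "length P"] that by simp
    then show ?thesis using P i(1) by blast
  qed
  then have "?M \<subseteq> (\<Union>i<length C. (\<lambda>n. inf_near n (C ! i)) ` {..<l ! i})" by (rule subsetI)
  then have "finite ?M" by (rule finite_subset) simp
  moreover have "P \<in> ?M" if "P @ [d] \<in> ?M" for P d
    using that on_branch_butlast[of "P @ [d]"]
    unfolding multiple_points_def mem_Collect_eq butlast_snoc by blast
  ultimately have "blowup_set ?M" by (auto simp: blowup_set_def)
  moreover have "(\<forall>j<length C. on_branch R (C ! j) \<longrightarrow> i = j) \<and> card {P \<in> ?M. on_exc P R} \<le> 1 \<and>
      (\<forall>P\<in>?M. \<not> on_exc P (inf_near (Suc (length R)) (C ! i)))"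
    if R: "R \<in> surface_points ?M" and i: "i < length C" and on: "on_branch R (C ! i)" for R i
  proof (intro conjI ballI)
    have notin: "R \<notin> ?M" using R by (simp add: surface_points_def)
    then show "\<forall>j<length C. on_branch R (C ! j) \<longrightarrow> i = j"
      using i on unfolding multiple_points_def mem_Collect_eq by blast
    have "{P \<in> ?M. on_exc P R} \<subseteq> {butlast R}" using on_exc_affine[OF aff[OF on i]] by blast
    then show "card {P \<in> ?M. on_exc P R} \<le> 1" using card_mono[of "{butlast R}"] by fastforce
    fix P assume "P \<in> ?M"
    have next_on: "on_branch (inf_near (Suc (length R)) (C ! i)) (C ! i)"
      by (simp add: on_branch_def del: inf_near.simps)
    have "butlast (inf_near (Suc (length R)) (C ! i)) = R"
      using on_branch_butlast[OF next_on] on by (simp add: on_branch_def del: inf_near.simps)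
    then show "\<not> on_exc P (inf_near (Suc (length R)) (C ! i))"
      unfolding on_exc_affine[OF aff[OF next_on i]] using notin \<open>P \<in> ?M\<close> by auto
  qed
  ultimately show ?thesis unfolding embedded_resolution_def by blast
qed

text \<open>
  The points of a branch that lie on a second branch form an initial segment, because two branches
  never meet again after they have separated.
\<close>

lemma multiple_points_on_branch:
  assumes "i < length C"
  shows "\<exists>N<l ! i. {n. inf_near n (C ! i) \<in> multiple_points C} = {..<N}"
proof -
  define D where "D = {n. inf_near n (C ! i) \<in> multiple_points C}"
  have D_bound: "Suc n < l ! i" if "n \<in> D" for n
    using bound assms that by (simp add: D_def)
  have D_down: "m \<in> D" if "n \<in> D" "m \<le> n" for m n
    using that on_branch_take[of "inf_near n (C ! i)" _ m]
    unfolding D_def multiple_points_def mem_Collect_eq inf_near_take[OF \<open>m \<le> n\<close>] by blast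
  define N where "N = (LEAST N. N \<notin> D)"
  have "l ! i \<notin> D" using D_bound by fastforce
  then have "N \<notin> D" unfolding N_def by (rule LeastI)
  have "n \<in> D" if "n < N" for n
    using that not_less_Least unfolding N_def by blast
  then have "D = {..<N}" using D_down \<open>N \<notin> D\<close> by (auto simp: not_less) (meson not_le)
  moreover have "N < l ! i"
  proof (cases N)
    case 0
    then show ?thesis using pos assms by simp
  next
    case (Suc n)
    then show ?thesis using D_bound[of n] \<open>D = {..<N}\<close> by simp
  qed
  ultimately show ?thesis unfolding D_def by blast
qed

context
  assumes min_res: "min_resolution C = multiple_points C"
begin

lemma min_blowups_less:
  assumes "i < length C"
  shows "min_blowups C i < l ! i"
proof -
  obtain N where "N < l ! i" "{n. inf_near n (C ! i) \<in> multiple_points C} = {..<N}"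
    using multiple_points_on_branch[OF assms] by blast
  then show ?thesis by (simp add: min_blowups_def min_res)
qed

text \<open>
  The centres added after the resolution continue each branch exactly where the initial segment of
  multiple points on it ends.
\<close>

lemma blown_up_points_eq:
  "blown_up_points C l = {inf_near n (C ! i) | i n. i < length C \<and> n < l ! i}"
proof -
  have early: "inf_near n (C ! i) \<in> multiple_points C \<longleftrightarrow> n < min_blowups C i"
    if i: "i < length C" for i n
  proof -
    obtain N where N: "{n. inf_near n (C ! i) \<in> multiple_points C} = {..<N}"
      using multiple_points_on_branch[OF i] by blast
    then have "inf_near n (C ! i) \<in> multiple_points C \<longleftrightarrow> n < N" by blast
    then show ?thesis by (simp add: min_blowups_def min_res N)
  qed
  have "P \<in> blown_up_points C l \<longleftrightarrow> (\<exists>i n. P = inf_near n (C ! i) \<and> i < length C \<and> n < l ! i)" for P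
  proof
    assume "P \<in> blown_up_points C l"
    then consider (mult) "P \<in> multiple_points C" |
      (free) i n where "P = inf_near n (C ! i)" "i < length C" "n < l ! i"
      unfolding blown_up_points_def min_res by blast
    then show "\<exists>i n. P = inf_near n (C ! i) \<and> i < length C \<and> n < l ! i"
    proof cases
      case mult
      then obtain i where i: "i < length C" "P = inf_near (length P) (C ! i)"
        unfolding multiple_points_def on_branch_def by blast
      then have "Suc (length P) < l ! i" using bound[OF i(1)] mult by metis
      then show ?thesis using i Suc_lessD by blast
    qed blast
  next
    assume "\<exists>i n. P = inf_near n (C ! i) \<and> i < length C \<and> n < l ! i"
    then show "P \<in> blown_up_points C l"
      unfolding blown_up_points_def min_res using early not_less by blast
  qed
  then show ?thesis by blast
qed

end

end

section \<open>The curve and its infinitely near points\<close>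

text \<open>
  The entry \<open>i\<close> is minus the self-intersection of the spine curve that lies \<open>i\<close> steps before the end
  of the spine. Each leaf attached to this curve is a blown-up point on it, and so is the next spine
  point, which is absent for \<open>i = 0\<close>.
\<close>

definition dual_expansion :: "nat \<Rightarrow> (nat \<Rightarrow> nat) \<Rightarrow> nat list" where
  "dual_expansion k T = map (\<lambda>i. (if i = 0 then 1 else 2) + card {j. j < k \<and> T j = T 0 - i}) [0..<T 0]"

definition spine :: "nat \<Rightarrow> inf_near_point" where
  "spine n = replicate n (Some 0)"

text \<open>
  A branch of the germ leaves the spine at its coefficient \<open>T j\<close>. The coefficients \<open>j + 1\<close> are
  nonzero and distinct, so leaves do not lie on the spine and different branches have different
  leaves, even for equal values of \<open>T\<close>.
\<close>

definition leaf :: "(nat \<Rightarrow> nat) \<Rightarrow> nat \<Rightarrow> inf_near_point" where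
  "leaf T j = replicate (T j - 1) (Some 0) @ [Some (of_nat (Suc j))]"

text \<open>
  The geometry depends on the continued fraction only through the orders of contact \<open>T i\<close> of the
  branches with the axis \<open>Y = 0\<close>.
\<close>

locale staircase =
  fixes k :: nat and T :: "nat \<Rightarrow> nat"
  assumes k_pos: "0 < k"
    and T_pos: "\<And>i. i < k \<Longrightarrow> 0 < T i"
    and T_antimono: "\<And>i j. i \<le> j \<Longrightarrow> j < k \<Longrightarrow> T j \<le> T i"
begin

definition curve :: "nat \<Rightarrow> branch" where
  "curve i = (fps_X, fps_const (of_nat (Suc i)) * fps_X ^ T i)"

definition germ :: "branch list" where
  "germ = map curve [0..<k]"

definition decoration :: "nat list" where
  "decoration = map (\<lambda>i. Suc (T i)) [0..<k]"

text \<open>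
  A common index set for the blown-up points and the marked points: \<open>Inl n\<close> stands for a spine point
  and \<open>Inr j\<close> for the leaf of the branch \<open>j\<close>.
\<close>

definition indices :: "(nat + nat) set" where
  "indices = Inl ` {..<T 0} \<union> Inr ` {..<k}"

definition point :: "nat + nat \<Rightarrow> inf_near_point" where
  "point = case_sum spine (leaf T)"

definition through :: "nat + nat \<Rightarrow> nat set" where
  "through = case_sum (\<lambda>n. {i. i < k \<and> n < T i}) (\<lambda>j. {j})"

lemma length_germ [simp]: "length germ = k"
  and nth_germ [simp]: "i < k \<Longrightarrow> germ ! i = curve i"
  by (simp_all add: germ_def)

lemma length_decoration [simp]: "length decoration = k"
  and nth_decoration [simp]: "i < k \<Longrightarrow> decoration ! i = Suc (T i)"
  by (simp_all add: decoration_def)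

lemma T_le_T0: "i < k \<Longrightarrow> T i \<le> T 0"
  using T_antimono[of 0 i] by simp

lemma inf_near_curve:
  assumes "i < k"
  shows "inf_near n (curve i) = map (\<lambda>m. Some (if Suc m = T i then of_nat (Suc i) else 0)) [0..<n]"
proof -
  have "fps_nth (fps_const (of_nat (Suc i)) * fps_X ^ T i :: complex fps) 0 = 0"
    using T_pos[OF assms] by simp
  from inf_near_graph[OF this, of n] show ?thesis
    by (simp add: curve_def if_distrib)
qed

lemma inf_near_curve_spine:
  assumes "i < k" "n < T i"
  shows "inf_near n (curve i) = spine n"
  using assms by (auto simp: inf_near_curve spine_def intro: nth_equalityI)

lemma inf_near_curve_leaf:
  assumes "i < k"
  shows "inf_near (T i) (curve i) = leaf T i"
proof (rule nth_equalityI)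
  show "length (inf_near (T i) (curve i)) = length (leaf T i)"
    using T_pos[OF assms] by (simp add: leaf_def)
next
  fix m assume "m < length (inf_near (T i) (curve i))"
  then show "inf_near (T i) (curve i) ! m = leaf T i ! m"
    using T_pos[OF assms] by (auto simp: leaf_def inf_near_curve[OF assms] nth_append)
qed

lemma on_branch_spine:
  assumes "i < k"
  shows "on_branch (spine n) (curve i) \<longleftrightarrow> n < T i"
proof
  assume "on_branch (spine n) (curve i)"
  then have eq: "spine n = inf_near n (curve i)" by (simp add: on_branch_def spine_def)
  show "n < T i"
  proof (rule ccontr)
    assume "\<not> n < T i"
    then have "T i - 1 < n" using T_pos[OF assms] by simp
    moreover have "spine n ! (T i - 1) = inf_near n (curve i) ! (T i - 1)" using eq by simp
    ultimately show False using T_pos[OF assms]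
      by (auto simp: spine_def inf_near_curve[OF assms] simp del: of_nat_Suc)
  qed
next
  assume "n < T i"
  then show "on_branch (spine n) (curve i)"
    using inf_near_curve_spine[OF assms] by (simp add: on_branch_def spine_def)
qed

lemma on_branch_leaf:
  assumes "i < k" "j < k"
  shows "on_branch (leaf T j) (curve i) \<longleftrightarrow> i = j"
proof
  have len: "length (leaf T j) = T j" using T_pos[OF assms(2)] by (simp add: leaf_def)
  assume "on_branch (leaf T j) (curve i)"
  then have "inf_near (T j) (curve j) = inf_near (T j) (curve i)"
    using len inf_near_curve_leaf[OF assms(2)] unfolding on_branch_def by simp
  then have "inf_near (T j) (curve j) ! (T j - 1) = inf_near (T j) (curve i) ! (T j - 1)"
    by (rule arg_cong)
  then show "i = j" using T_pos[OF assms(2)]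
    by (auto simp: inf_near_curve[OF assms(1)] inf_near_curve[OF assms(2)] split: if_splits
        simp del: of_nat_Suc)
next
  assume "i = j"
  then show "on_branch (leaf T j) (curve i)"
    using inf_near_curve_leaf[OF assms(2)] T_pos[OF assms(2)]
    unfolding on_branch_def by (simp add: leaf_def)
qed

lemma on_branch_point:
  assumes "i < k" "x \<in> indices"
  shows "on_branch (point x) (curve i) \<longleftrightarrow> i \<in> through x"
  using assms on_branch_spine on_branch_leaf by (auto simp: indices_def point_def through_def)

text \<open>
  The point number \<open>T i\<close> of the branch \<open>i\<close> is its leaf, through which no other branch passes.
\<close>

lemma multiple_points_before_end:
  assumes "i < k" "inf_near n (curve i) \<in> multiple_points germ"
  shows "n < T i"
proof (rule ccontr)
  assume "\<not> n < T i"
  obtain i' j' where ij: "i' < k" "j' < k" "i' \<noteq> j'"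
    "on_branch (inf_near n (curve i)) (germ ! i')" "on_branch (inf_near n (curve i)) (germ ! j')"
    using assms(2) unfolding multiple_points_def by auto
  define j where "j = (if i' = i then j' else i')"
  have j: "j < k" "j \<noteq> i" "on_branch (inf_near n (curve i)) (curve j)"
    using ij by (auto simp: j_def)
  have "take (T i) (inf_near n (curve i)) = leaf T i"
    using \<open>\<not> n < T i\<close> inf_near_take[of "T i" n] inf_near_curve_leaf[OF assms(1)] by simp
  then have "on_branch (leaf T i) (curve j)" using on_branch_take[OF j(3), of "T i"] by simp
  then show False using on_branch_leaf[OF j(1) assms(1)] j(2) by simp
qed

lemma min_resolution_germ: "min_resolution germ = multiple_points germ"
proof (rule min_resolution_eq_multiple_points, rule embedded_resolution_multiple_points)
  show "0 < decoration ! i" if "i < length germ" for i using that by simp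
  show "Suc n < decoration ! i"
    if "i < length germ" "inf_near n (germ ! i) \<in> multiple_points germ" for i n
    using that multiple_points_before_end by simp
  show "\<exists>y. b = (fps_X, y) \<and> fps_nth y 0 = 0" if b: "b \<in> set germ" for b
  proof -
    obtain i where i: "i < k" "b = curve i" using b by (auto simp: germ_def)
    then show ?thesis using T_pos[OF i(1)] by (simp add: curve_def)
  qed
qed

lemma min_blowups_germ: "i < k \<Longrightarrow> min_blowups germ i < decoration ! i"
  using min_blowups_less[of germ decoration i] min_resolution_germ multiple_points_before_end by simp

lemma mem_blown_up_points_germ:
  "P \<in> blown_up_points germ decoration \<longleftrightarrow> (\<exists>i<k. \<exists>n\<le>T i. P = inf_near n (curve i))"
proof -
  have "blown_up_points germ decoration = {inf_near n (germ ! i) | i n. i < length germ \<and> n < decoration ! i}"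
    by (rule blown_up_points_eq) (use min_resolution_germ multiple_points_before_end in simp_all)
  then have "P \<in> blown_up_points germ decoration \<longleftrightarrow>
      (\<exists>i n. P = inf_near n (germ ! i) \<and> i < k \<and> n < decoration ! i)" by simp
  also have "\<dots> \<longleftrightarrow> (\<exists>i<k. \<exists>n\<le>T i. P = inf_near n (curve i))"
    using nth_germ nth_decoration by (metis less_Suc_eq_le)
  finally show ?thesis .
qed

lemma blown_up_points_germ: "blown_up_points germ decoration = point ` indices"
proof (intro subset_antisym subsetI)
  fix P assume "P \<in> blown_up_points germ decoration"
  then obtain i n where i: "i < k" "n \<le> T i" "P = inf_near n (curve i)"
    unfolding mem_blown_up_points_germ by blast
  show "P \<in> point ` indices"
  proof (cases "n = T i")
    case True
    then have "P = point (Inr i)" using i inf_near_curve_leaf by (simp add: point_def)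
    moreover have "Inr i \<in> indices" using i by (simp add: indices_def)
    ultimately show ?thesis by blast
  next
    case False
    then have "P = point (Inl n)" using i inf_near_curve_spine by (simp add: point_def)
    moreover have "Inl n \<in> indices" using i False T_le_T0[OF i(1)] by (simp add: indices_def)
    ultimately show ?thesis by blast
  qed
next
  fix P assume "P \<in> point ` indices"
  then consider n where "n < T 0" "P = spine n" | i where "i < k" "P = leaf T i"
    by (auto simp: point_def indices_def)
  then show "P \<in> blown_up_points germ decoration"
  proof cases
    case 1
    then have "P = inf_near n (curve 0)" using k_pos inf_near_curve_spine by simp
    then show ?thesis unfolding mem_blown_up_points_germ using k_pos 1 less_imp_le by blast
  next
    case 2
    then have "P = inf_near (T i) (curve i)" using inf_near_curve_leaf by simp
    then show ?thesis unfolding mem_blown_up_points_germ using 2 by blast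
  qed
qed

lemma spine_eq_iff [simp]: "spine m = spine n \<longleftrightarrow> m = n"
  by (metis length_replicate spine_def)

lemma leaf_eq_iff [simp]: "leaf T i = leaf T j \<longleftrightarrow> i = j"
  by (auto simp: leaf_def simp del: of_nat_Suc)

lemma spine_neq_leaf [simp]: "spine n \<noteq> leaf T j" "leaf T j \<noteq> spine n"
proof -
  have "Some (of_nat (Suc j)) \<in> set (leaf T j)" by (simp add: leaf_def)
  moreover have "Some (of_nat (Suc j)) \<notin> set (spine n)"
    by (simp add: spine_def del: of_nat_Suc)
  ultimately show "spine n \<noteq> leaf T j" "leaf T j \<noteq> spine n" by auto
qed

lemma spine_eq_Nil [simp]: "spine n = [] \<longleftrightarrow> n = 0"
  by (simp add: spine_def)

lemma leaf_neq_Nil [simp]: "leaf T j \<noteq> []"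
  by (simp add: leaf_def)

lemma butlast_spine [simp]: "butlast (spine n) = spine (n - 1)"
  by (cases n) (simp_all add: spine_def flip: replicate_append_same)

lemma butlast_leaf [simp]: "butlast (leaf T j) = spine (T j - 1)"
  by (simp add: leaf_def spine_def)

lemma inj_point: "inj point"
proof (rule injI)
  fix x y assume "point x = point y"
  then show "x = y" by (cases x; cases y) (simp_all add: point_def)
qed

lemma point_affine: "None \<notin> set (point x)"
  by (cases x) (auto simp: point_def spine_def leaf_def)

text \<open>
  The blown-up points on the curve of a spine point are the next spine point and the leaves that are
  attached there.
\<close>

lemma self_int_spine:
  assumes "n < T 0"
  shows "self_int (point ` indices) (spine n) =
    - 1 - (if Suc n < T 0 then 1 else 0) - int (card {j. j < k \<and> T j = Suc n})"
proof -
  let ?A = "Inl ` (if Suc n < T 0 then {Suc n} else {}) :: (nat + nat) set"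
    and ?B = "Inr ` {j. j < k \<and> T j = Suc n} :: (nat + nat) set"
  have "on_exc (spine n) (point x) \<longleftrightarrow> x \<in> ?A \<union> ?B" if "x \<in> indices" for x
    using that on_exc_affine[OF point_affine, of "spine n" x] T_pos
    by (cases x) (auto simp: point_def indices_def)
  then have "{Q \<in> point ` indices. on_exc (spine n) Q} = point ` (?A \<union> ?B)"
    by (auto simp: indices_def split: if_splits)
  then have "card {Q \<in> point ` indices. on_exc (spine n) Q} = card (?A \<union> ?B)"
    using card_image[OF inj_on_subset[OF inj_point]] by simp
  also have "\<dots> = card ?A + card ?B"
    by (intro card_Un_disjoint) auto
  also have "\<dots> = (if Suc n < T 0 then 1 else 0) + card {j. j < k \<and> T j = Suc n}"
    by (simp add: card_image)
  finally show ?thesis by (simp add: self_int_def)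
qed

lemma self_int_leaf: "self_int (point ` indices) (leaf T j) = - 1"
proof -
  have "\<not> on_exc (leaf T j) (point x)" for x
    using on_exc_affine[OF point_affine, of "leaf T j" x] by (cases x) (auto simp: point_def)
  then have "{Q \<in> point ` indices. on_exc (leaf T j) Q} = {}" by blast
  then show ?thesis unfolding self_int_def by (simp only: card.empty)
qed

lemma exc_meets_curve:
  assumes "i < k"
  shows "exc_meets_branch (point ` indices) P (curve i) \<longleftrightarrow> P = leaf T i"
proof -
  have "inf_near n (curve i) \<in> point ` indices \<longleftrightarrow> n < Suc (T i)" for n
  proof
    assume "n < Suc (T i)"
    then have "inf_near n (curve i) \<in> blown_up_points germ decoration"
      unfolding mem_blown_up_points_germ using assms by (auto simp: less_Suc_eq_le)
    then show "inf_near n (curve i) \<in> point ` indices" by (simp add: blown_up_points_germ)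
  next
    assume "inf_near n (curve i) \<in> point ` indices"
    then obtain x where x: "x \<in> indices" "inf_near n (curve i) = point x" by blast
    then have "on_branch (point x) (curve i)" by (metis length_inf_near on_branch_def)
    then have "i \<in> through x" using on_branch_point[OF assms x(1)] by simp
    moreover have "n = length (point x)" using x(2) by (metis length_inf_near)
    ultimately show "n < Suc (T i)" using T_pos[OF assms]
      by (cases x) (auto simp: through_def point_def spine_def leaf_def)
  qed
  moreover have "None \<notin> set (inf_near (Suc (T i)) (curve i))"
    by (auto simp: inf_near_curve[OF assms])
  ultimately have "exc_meets_branch (point ` indices) P (curve i) \<longleftrightarrow>
      P = inf_near (Suc (T i) - 1) (curve i)" by (intro exc_meets_graph) auto
  then show ?thesis using inf_near_curve_leaf[OF assms] by simp
qed

end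

section \<open>Riemenschneider duality\<close>

text \<open>
  The drops between consecutive levels are to be the numbers of twists, apart from one extra twist on
  the first wire. Every entry \<open>x\<close> of \<open>b\<close> but the last stands for \<open>x - 2\<close> twists; the summand \<open>1\<close> accounts for
  the last entry, which stands for \<open>x - 1\<close>.
\<close>

definition levels :: "nat list \<Rightarrow> nat \<Rightarrow> nat" where
  "levels b i = Suc (sum_list (map (\<lambda>x. x - 2) (drop i b)))"

lemma staircase_levels:
  assumes "b \<noteq> []"
  shows "staircase (length b) (levels b)"
proof
  show "levels b j \<le> levels b i" if "i \<le> j" for i j
  proof -
    have "sum_list (drop n xs) \<le> sum_list xs" for n and xs :: "nat list"
      by (metis append_take_drop_id le_add2 sum_list_append)
    from this[of "j - i" "map (\<lambda>x. x - 2) (drop i b)"] show ?thesis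
      using that by (simp add: levels_def drop_map)
  qed
qed (use assms in \<open>simp_all add: levels_def\<close>)

lemma hj_cf_gt_1:
  assumes "bs \<noteq> []" "\<forall>b\<in>set bs. 2 \<le> b"
  shows "hj_cf bs > 1"
  using assms
proof (induction bs rule: hj_cf.induct)
  case (3 b c cs)
  then have "hj_cf (c # cs) > 1" by simp
  then have "1 / hj_cf (c # cs) < 1" by simp
  moreover have "(2::rat) \<le> of_nat b" using 3(3) by (metis list.set_intros(1) of_nat_le_iff of_nat_numeral)
  ultimately show ?case by simp
next
  case (2 b)
  then have "(2::rat) \<le> of_nat b" by (metis list.set_intros(1) of_nat_le_iff of_nat_numeral)
  then show ?case by simp
qed simp

lemma hj_cf_Cons: "bs \<noteq> [] \<Longrightarrow> hj_cf (b # bs) = of_nat b - 1 / hj_cf bs"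
  by (cases bs) simp_all

lemma hj_cf_Suc: "hj_cf (Suc b # bs) = hj_cf (b # bs) + 1"
  by (cases bs) simp_all

lemma length_dual_expansion: "length (dual_expansion k T) = T 0"
  by (simp add: dual_expansion_def)

lemma nth_dual_expansion:
  "i < T 0 \<Longrightarrow> dual_expansion k T ! i = (if i = 0 then 1 else 2) + card {j. j < k \<and> T j = T 0 - i}"
  by (simp add: dual_expansion_def)

lemma dual_expansion_Cons:
  assumes "T 0 = Suc t"
  shows "dual_expansion k T = Suc (card {j. j < k \<and> T j = T 0}) #
    map (\<lambda>i. 2 + card {j. j < k \<and> T j = t - i}) [0..<t]"
  unfolding dual_expansion_def assms
  by (simp add: upt_conv_Cons comp_def del: upt_Suc flip: map_Suc_upt)

text \<open>
  Prepending the entry \<open>2\<close> to \<open>b\<close> repeats the first level, which adds one leaf at the end of the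
  spine.
\<close>

lemma dual_expansion_repeat_level:
  assumes "0 < T 0"
  shows "dual_expansion (Suc k) (case_nat (T 0) T) = Suc (hd (dual_expansion k T)) # tl (dual_expansion k T)"
proof -
  obtain t where t: "T 0 = Suc t" using assms by (cases "T 0") auto
  have *: "{j. j < Suc k \<and> case_nat (T 0) T j = v} =
      (if v = T 0 then {0} else {}) \<union> Suc ` {j. j < k \<and> T j = v}" for v
  proof (rule Set.set_eqI)
    show "x \<in> {j. j < Suc k \<and> case_nat (T 0) T j = v} \<longleftrightarrow>
        x \<in> (if v = T 0 then {0} else {}) \<union> Suc ` {j. j < k \<and> T j = v}" for x
      by (cases x) auto
  qed
  have card: "card {j. j < Suc k \<and> case_nat (T 0) T j = v} =
      (if v = T 0 then 1 else 0) + card {j. j < k \<and> T j = v}" for v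
    unfolding * by (subst card_Un_disjoint) (auto simp: card_image)
  have t': "case_nat (T 0) T 0 = Suc t" using t by simp
  show ?thesis
    unfolding dual_expansion_Cons[of "case_nat (T 0) T", OF t'] dual_expansion_Cons[of T, OF t] unfolding card
    using t by (auto intro!: map_cong)
qed

text \<open>
  Increasing the first entry of \<open>b\<close> raises only the first level. The spine becomes longer by one
  curve, to which a single leaf is attached.
\<close>

lemma dual_expansion_raise_first_level:
  assumes "0 < k" "0 < T 0" "\<And>j. j < k \<Longrightarrow> T j \<le> T 0"
  shows "dual_expansion k (T(0 := Suc (T 0))) = 2 # dual_expansion k T"
proof -
  let ?T = "T(0 := Suc (T 0))"
  have first: "{j. j < k \<and> ?T j = ?T 0} = {0}"
    using assms by (auto split: if_splits) (metis Suc_n_not_le_n)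
  have later: "2 + card {j. j < k \<and> ?T j = T 0 - i} =
      (if i = 0 then 1 else 2) + card {j. j < k \<and> T j = T 0 - i}" if "i < T 0" for i
  proof (cases "i = 0")
    case True
    have "{j. j < k \<and> T j = T 0} = insert 0 {j. j < k \<and> ?T j = T 0}" using assms(1) by auto
    then have "card {j. j < k \<and> T j = T 0} = Suc (card {j. j < k \<and> ?T j = T 0})" by simp
    then show ?thesis using True by simp
  next
    case False
    then have "{j. j < k \<and> ?T j = T 0 - i} = {j. j < k \<and> T j = T 0 - i}" using assms(2) by auto
    then show ?thesis using False by simp
  qed
  have "dual_expansion k ?T = 2 # map (\<lambda>i. 2 + card {j. j < k \<and> ?T j = T 0 - i}) [0..<T 0]"
    by (subst dual_expansion_Cons[of ?T "T 0"]) (use first in simp_all)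
  also have "\<dots> = 2 # dual_expansion k T" using later by (simp add: dual_expansion_def)
  finally show ?thesis .
qed

lemma levels_pos: "0 < levels b i"
  by (simp add: levels_def)

text \<open>
  With \<open>x = hj_cf b\<close> the claim is that \<open>x\<close> and the value \<open>y\<close> of the dual expansion satisfy
  \<open>1 / x + 1 / y = 1\<close>. Every \<open>b\<close> arises from \<open>[2]\<close> by prepending \<open>2\<close> and by increasing the first entry.
  These operations replace \<open>x\<close> by \<open>2 - 1 / x\<close> and by \<open>x + 1\<close>, and correspondingly \<open>y\<close> by \<open>y + 1\<close> and by
  \<open>2 - 1 / y\<close>, which preserves the relation.
\<close>

lemma riemenschneider_duality:
  assumes "b \<noteq> []" "\<forall>x\<in>set b. 2 \<le> x"
  shows "hj_cf (dual_expansion (length b) (levels b)) = hj_cf b / (hj_cf b - 1)"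
  using assms
proof (induction "sum_list b" arbitrary: b rule: less_induct)
  case less
  then obtain c bs where b: "b = c # bs" by (cases b) auto
  have not_Nil: "dual_expansion k (levels b) \<noteq> []" for k b
    by (simp add: dual_expansion_def levels_def)
  show ?case
  proof (cases "c = 2")
    case c: True
    show ?thesis
    proof (cases "bs = []")
      case True
      have "{j. j < Suc 0 \<and> levels b j = Suc 0} = {0}" using b c True by (auto simp: levels_def)
      then have "dual_expansion (length b) (levels b) = [2]" using b c True
        by (simp add: dual_expansion_def levels_def)
      then show ?thesis using b c True by simp
    next
      case False
      let ?x = "hj_cf bs" and ?a = "dual_expansion (length bs) (levels bs)"
      have bs: "\<forall>x\<in>set bs. 2 \<le> x" using less.prems b by simp
      have x: "?x > 1" by (rule hj_cf_gt_1[OF False bs])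
      have "levels b = case_nat (levels bs 0) (levels bs)"
        using b c by (auto simp: levels_def fun_eq_iff split: nat.splits)
      then have "dual_expansion (length b) (levels b) = Suc (hd ?a) # tl ?a"
        using dual_expansion_repeat_level[of "levels bs" "length bs", OF levels_pos] b by simp
      then have "hj_cf (dual_expansion (length b) (levels b)) = hj_cf ?a + 1"
        using hj_cf_Suc[of "hd ?a" "tl ?a"] not_Nil[of "length bs" bs] by simp
      also have "hj_cf ?a = ?x / (?x - 1)"
        using less.hyps[of bs] b c False bs by simp
      also have "?x / (?x - 1) + 1 = (2 - 1 / ?x) / (2 - 1 / ?x - 1)"
        using x by (simp add: field_simps)
      also have "2 - 1 / ?x = hj_cf b" using b c by (simp add: hj_cf_Cons[OF False])
      finally show ?thesis .
    qed
  next
    case False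
    then obtain d where d: "c = Suc d" "2 \<le> d" using less.prems b by (cases c) auto
    let ?b = "d # bs"
    have b2: "\<forall>x\<in>set ?b. 2 \<le> x" using less.prems b d by simp
    interpret staircase "length ?b" "levels ?b" by (rule staircase_levels) simp
    have "levels b = (levels ?b)(0 := Suc (levels ?b 0))"
      using b d by (auto simp: levels_def fun_eq_iff Suc_diff_le drop_Cons split: nat.splits)
    then have "dual_expansion (length b) (levels b) = 2 # dual_expansion (length ?b) (levels ?b)"
      using dual_expansion_raise_first_level[of "length ?b" "levels ?b"] T_le_T0 levels_pos b by simp
    then have "hj_cf (dual_expansion (length b) (levels b)) = 2 - 1 / hj_cf (dual_expansion (length ?b) (levels ?b))"
      using hj_cf_Cons[OF not_Nil] by simp
    also have "hj_cf (dual_expansion (length ?b) (levels ?b)) = hj_cf ?b / (hj_cf ?b - 1)"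
      using less.hyps[of ?b] b d b2 by simp
    also have "2 - 1 / \<dots> = hj_cf b / (hj_cf b - 1)"
    proof -
      have "hj_cf ?b > 1" by (rule hj_cf_gt_1[OF _ b2]) simp
      moreover have "hj_cf b = hj_cf ?b + 1" using b d hj_cf_Suc by simp
      ultimately show ?thesis by (simp add: field_simps)
    qed
    finally show ?thesis .
  qed
qed

lemma (in staircase) dual_expansion_ge_2: "x \<in> set (dual_expansion k T) \<Longrightarrow> 2 \<le> x"
proof -
  have "0 \<in> {j. j < k \<and> T j = T 0}" using k_pos by simp
  then have "0 < card {j. j < k \<and> T j = T 0}" by (subst card_gt_0_iff) auto
  then show "x \<in> set (dual_expansion k T) \<Longrightarrow> 2 \<le> x" by (auto simp: dual_expansion_def)
qed

lemma is_hj_expansion_dual: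
  fixes p q :: nat
  assumes "is_hj_expansion b (of_nat p / of_nat (p - q))" "1 \<le> q" "q < p"
  shows "is_hj_expansion (dual_expansion (length b) (levels b)) (of_nat p / of_nat q)"
proof -
  have b: "b \<noteq> []" "\<forall>x\<in>set b. 2 \<le> x" "hj_cf b = of_nat p / of_nat (p - q)"
    using assms(1) by (auto simp: is_hj_expansion_def)
  interpret staircase "length b" "levels b" by (rule staircase_levels[OF b(1)])
  have pq: "of_nat (p - q) = of_nat p - (of_nat q :: rat)" "(of_nat q :: rat) < of_nat p"
    "(0 :: rat) < of_nat q"
    using assms by (simp_all add: of_nat_diff)
  have "hj_cf (dual_expansion (length b) (levels b)) = of_nat p / of_nat q"
    unfolding riemenschneider_duality[OF b(1,2)] b(3) pq(1) using pq(2,3) by (simp add: field_simps)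
  moreover have "dual_expansion (length b) (levels b) \<noteq> []" by (simp add: dual_expansion_def levels_def)
  ultimately show ?thesis using dual_expansion_ge_2 by (simp add: is_hj_expansion_def)
qed

section \<open>The resolution graph\<close>

text \<open>
  The new vertices of the graph are the exceptional curves that meet the proper transform of the
  germ, so what is collapsed is the chain itself.
\<close>

lemma cyclic_quotient_germ_represents:
  assumes "cyclic_quotient_germ p q C l"
  shows "represents_cyclic_quotient p q C l"
proof -
  let ?S = "blown_up_points C l"
  obtain a \<phi> \<psi> where a: "is_hj_expansion a (of_nat p / of_nat q)"
    and \<phi>: "bij_betw \<phi> (graph_vertices a) ?S"
    and \<psi>: "bij_betw \<psi> {..<length C} (new_vertices a)"
    and weight: "\<forall>u\<in>graph_vertices a. self_int ?S (\<phi> u) = graph_weight a u"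
    and adj: "\<forall>u\<in>graph_vertices a. \<forall>u'\<in>graph_vertices a.
      exc_adjacent ?S (\<phi> u) (\<phi> u') \<longleftrightarrow> graph_adjacent u u'"
    and meets: "\<forall>u\<in>graph_vertices a. \<forall>i<length C.
      exc_meets_branch ?S (\<phi> u) (C ! i) \<longleftrightarrow> u = Inr (\<psi> i)"
    using assms unfolding cyclic_quotient_germ_def Let_def by (elim exE conjE) (rule that)
  have chain: "Inl i \<in> graph_vertices a" if "i < length a" for i
    using that by (simp add: graph_vertices_def)
  have "bij_betw (\<lambda>i. \<phi> (Inl i)) {..<length a} {P \<in> ?S. \<forall>b\<in>set C. \<not> exc_meets_branch ?S P b}"
  proof (rule bij_betw_imageI)
    have "inj_on (\<phi> \<circ> Inl) {..<length a}"
      using \<phi> chain by (intro comp_inj_on) (auto simp: bij_betw_def intro: inj_on_subset)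
    then show "inj_on (\<lambda>i. \<phi> (Inl i)) {..<length a}" by (simp add: comp_def)
    show "(\<lambda>i. \<phi> (Inl i)) ` {..<length a} = {P \<in> ?S. \<forall>b\<in>set C. \<not> exc_meets_branch ?S P b}"
    proof (intro subset_antisym subsetI)
      fix P assume "P \<in> (\<lambda>i. \<phi> (Inl i)) ` {..<length a}"
      then obtain i where i: "i < length a" "P = \<phi> (Inl i)" by blast
      have "\<not> exc_meets_branch ?S P (C ! j)" if "j < length C" for j
        using meets chain[OF i(1)] that i(2) by simp
      then have "\<forall>b\<in>set C. \<not> exc_meets_branch ?S P b" by (metis in_set_conv_nth)
      moreover have "P \<in> ?S" using \<phi> chain[OF i(1)] i(2) by (simp add: bij_betw_apply)
      ultimately show "P \<in> {P \<in> ?S. \<forall>b\<in>set C. \<not> exc_meets_branch ?S P b}" by simp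
    next
      fix P assume P: "P \<in> {P \<in> ?S. \<forall>b\<in>set C. \<not> exc_meets_branch ?S P b}"
      then obtain u where u: "u \<in> graph_vertices a" "P = \<phi> u"
        using \<phi> by (auto simp: bij_betw_def)
      show "P \<in> (\<lambda>i. \<phi> (Inl i)) ` {..<length a}"
      proof (cases u)
        case (Inl i)
        then show ?thesis using u by (auto simp: graph_vertices_def)
      next
        case (Inr x)
        then have "x \<in> new_vertices a" using u by (auto simp: graph_vertices_def)
        then obtain j where "j < length C" "x = \<psi> j" using \<psi> by (auto simp: bij_betw_def)
        then have "exc_meets_branch ?S P (C ! j)" using meets u Inr by simp
        then show ?thesis using P \<open>j < length C\<close> by simp
      qed
    qed
  qed
  then show ?thesis
    unfolding represents_cyclic_quotient_def Let_def
    by (intro exI[of _ a] exI[of _ "\<lambda>i. \<phi> (Inl i)"])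
      (use a weight adj chain in \<open>simp add: graph_weight.simps graph_adjacent.simps\<close>)
qed

lemma pullback_equation_graph:
  assumes "fps_nth y 0 = 0" "fps_nth v 0 = 0"
  shows "pullback_equation (fps_X, y) (fps_X, v) = y - v"
proof -
  have "fps_inv fps_X oo fps_X = (fps_X :: complex fps)" by (rule fps_inv) simp_all
  then have "fps_inv fps_X = (fps_X :: complex fps)" by simp
  then show ?thesis by (simp add: pullback_equation_def)
qed

lemma card_geodesic:
  assumes "fst x = length a - t" "t \<le> length a"
  shows "card (geodesic a x) = Suc t"
  using assms by (cases x) (simp add: card_insert_if image_iff card_image)

lemma card_geodesic_Int:
  assumes "fst x = length a - t" "fst x' = length a - t'" "x \<noteq> x'" "t \<le> length a" "t' \<le> length a"
  shows "card (geodesic a x \<inter> geodesic a x') = min t t'"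
proof -
  have "geodesic a x \<inter> geodesic a x' = Inl ` {max (fst x) (fst x')..<length a}"
    using assms(3) by (cases x; cases x') auto
  then show ?thesis using assms by (simp add: card_image)
qed

context staircase
begin

text \<open>
  The leaves attached to a vertex of the chain are numbered arbitrarily.
\<close>

lemma ex_arrowhead_enumeration:
  "\<exists>\<psi>. bij_betw \<psi> {..<k} (new_vertices (dual_expansion k T)) \<and> (\<forall>i<k. fst (\<psi> i) = T 0 - T i)"
proof -
  let ?J = "\<lambda>i. {j. j < k \<and> T j = T 0 - i}"
  have "\<exists>e. bij_betw e (?J i) {..<card (?J i)}" for i
    using ex_bij_betw_finite_nat[of "?J i"] by (simp add: atLeast0LessThan)
  then obtain e where e: "bij_betw (e i) (?J i) {..<card (?J i)}" for i by metis
  define \<psi> where "\<psi> j = (T 0 - T j, e (T 0 - T j) j)" for j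
  have J: "j \<in> ?J (T 0 - T j)" if "j < k" for j using that T_le_T0 by simp
  have T0: "0 < T 0" using T_pos k_pos by blast
  have new: "new_vertices (dual_expansion k T) = {(i, c). i < T 0 \<and> c < card (?J i)}"
    using T0 by (auto simp: new_vertices_def length_dual_expansion nth_dual_expansion split: if_splits)
  have "bij_betw \<psi> {..<k} (new_vertices (dual_expansion k T))"
  proof (rule bij_betw_imageI)
    show "inj_on \<psi> {..<k}"
    proof (rule inj_onI)
      fix i j assume ij: "i \<in> {..<k}" "j \<in> {..<k}" "\<psi> i = \<psi> j"
      then have "(T 0 - T i, e (T 0 - T i) i) = (T 0 - T j, e (T 0 - T j) j)"
        unfolding \<psi>_def by blast
      then have eq: "T 0 - T i = T 0 - T j" "e (T 0 - T j) i = e (T 0 - T j) j"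
        by (metis prod.inject)+
      have "i \<in> ?J (T 0 - T i)" "j \<in> ?J (T 0 - T j)" using J ij(1,2) by blast+
      then show "i = j"
        using inj_onD[OF bij_betw_imp_inj_on[OF e[of "T 0 - T j"]] eq(2)] unfolding eq(1) by blast
    qed
    show "\<psi> ` {..<k} = new_vertices (dual_expansion k T)"
    proof (intro subset_antisym subsetI)
      fix x assume "x \<in> \<psi> ` {..<k}"
      then obtain j where j: "j < k" "x = \<psi> j" by blast
      have "e (T 0 - T j) j < card (?J (T 0 - T j))" using bij_betw_apply[OF e J[OF j(1)]] by simp
      moreover have "T 0 - T j < T 0" using T_pos[OF j(1)] T0 by simp
      ultimately show "x \<in> new_vertices (dual_expansion k T)" using j new by (simp add: \<psi>_def)
    next
      fix x assume "x \<in> new_vertices (dual_expansion k T)"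
      then obtain i c where x: "x = (i, c)" "i < T 0" "c < card (?J i)" using new by auto
      then have "c \<in> e i ` ?J i"
        unfolding bij_betw_imp_surj_on[OF e[of i]] lessThan_iff by blast
      then obtain j where j: "j \<in> ?J i" "e i j = c" by blast
      then have "T j = T 0 - i" by blast
      then have "T 0 - T j = i" using x(2) by arith
      then have "\<psi> j = x" using x(1) j(2) by (simp add: \<psi>_def)
      moreover have "j \<in> {..<k}" using j(1) by blast
      ultimately show "x \<in> \<psi> ` {..<k}" by blast
    qed
  qed
  moreover have "fst (\<psi> i) = T 0 - T i" for i by (simp add: \<psi>_def)
  ultimately show ?thesis by blast
qed

lemma intersection_mult_curve:
  assumes "i < k" "j < k" "i \<noteq> j"
  shows "pullback_equation (curve i) (curve j) \<noteq> 0"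
    and "intersection_mult (curve i) (curve j) = min (T i) (T j)"
proof -
  let ?f = "\<lambda>i. fps_const (of_nat (Suc i)) * fps_X ^ T i :: complex fps"
  have eq: "pullback_equation (curve i) (curve j) = ?f i - ?f j"
    unfolding curve_def by (rule pullback_equation_graph) (use T_pos[OF assms(1)] T_pos[OF assms(2)] in simp_all)
  have nth: "fps_nth (?f i - ?f j) (min (T i) (T j)) \<noteq> 0"
    using assms(3) T_pos[OF assms(1)] T_pos[OF assms(2)]
    by (auto simp: min_def simp del: of_nat_Suc)
  then have "?f i - ?f j \<noteq> 0" by (metis fps_zero_nth)
  then show "pullback_equation (curve i) (curve j) \<noteq> 0" using eq by simp
  have "subdegree (?f i - ?f j) = min (T i) (T j)"
    by (rule subdegreeI[OF nth]) simp
  then show "intersection_mult (curve i) (curve j) = min (T i) (T j)"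
    by (simp add: intersection_mult_def eq)
qed

lemma decorated_germ_germ: "decorated_germ germ decoration"
proof -
  have "smooth_branch (curve i)" if "i < k" for i
  proof -
    have "fps_conv_radius (fps_const (of_nat (Suc i)) * fps_X ^ T i :: complex fps) > 0"
      by (subst fps_conv_radius_cmult_left) (simp_all del: of_nat_Suc)
    then show ?thesis using T_pos[OF that] by (simp add: smooth_branch_def curve_def)
  qed
  then have "plane_curve_germ germ"
    unfolding plane_curve_germ_def using intersection_mult_curve(1) k_pos
    by (auto simp: germ_def)
  then show ?thesis unfolding decorated_germ_def using min_blowups_germ by simp
qed

text \<open>
  The vertex \<open>i\<close> of the chain is the spine curve \<open>i\<close> steps before the end, so that the last vertex
  of the chain is the exceptional curve of the first blowup. A new vertex is the curve of a leaf.
\<close>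

lemma cyclic_quotient_germ_germ:
  assumes "is_hj_expansion (dual_expansion k T) (of_nat p / of_nat q)"
  shows "cyclic_quotient_germ p q germ decoration"
proof -
  let ?a = "dual_expansion k T"
  note len = length_dual_expansion[of k T]
  obtain \<psi> where \<psi>: "bij_betw \<psi> {..<k} (new_vertices ?a)"
    and fst: "\<And>i. i < k \<Longrightarrow> fst (\<psi> i) = T 0 - T i"
    using ex_arrowhead_enumeration by blast
  define head where "head = inv_into {..<k} \<psi>"
  have head: "bij_betw head (new_vertices ?a) {..<k}"
    unfolding head_def by (rule bij_betw_inv_into[OF \<psi>])
  have \<psi>_head: "\<psi> (head x) = x" if "x \<in> new_vertices ?a" for x
    unfolding head_def by (rule bij_betw_inv_into_right[OF \<psi> that])
  have head_less: "head x < k" if "x \<in> new_vertices ?a" for x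
    using bij_betw_apply[OF head that] by simp
  have T_head: "T 0 - T (head x) = fst x" if "x \<in> new_vertices ?a" for x
    using fst[OF head_less[OF that]] \<psi>_head[OF that] by simp
  define pos where "pos = case_sum (\<lambda>i. Inl (T 0 - 1 - i)) (\<lambda>x. Inr (head x) :: nat + nat)"
  have pos: "bij_betw pos (graph_vertices ?a) indices"
  proof (rule bij_betw_imageI)
    show "inj_on pos (graph_vertices ?a)"
    proof (rule inj_onI)
      fix u u' assume uu: "u \<in> graph_vertices ?a" "u' \<in> graph_vertices ?a" "pos u = pos u'"
      show "u = u'"
      proof (cases u; cases u')
        fix i j assume ij: "u = Inl i" "u' = Inl j"
        then have "i < T 0" "j < T 0" using uu(1,2) by (auto simp: graph_vertices_def len)
        moreover have "T 0 - 1 - i = T 0 - 1 - j" using uu(3) unfolding ij pos_def by simp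
        ultimately have "i = j" by arith
        then show ?thesis using ij by simp
      next
        fix x x' assume xx: "u = Inr x" "u' = Inr x'"
        then have "x \<in> new_vertices ?a" "x' \<in> new_vertices ?a"
          using uu(1,2) by (auto simp: graph_vertices_def)
        moreover have "head x = head x'" using uu(3) unfolding xx pos_def by simp
        ultimately have "x = x'" using inj_onD[OF bij_betw_imp_inj_on[OF head]] by blast
        then show ?thesis using xx by simp
      qed (use uu(3) in \<open>simp_all add: pos_def\<close>)
    qed
    have "pos ` graph_vertices ?a = (\<lambda>i. Inl (T 0 - 1 - i)) ` {..<T 0} \<union> Inr ` head ` new_vertices ?a"
      by (simp add: graph_vertices_def image_Un image_image pos_def len)
    also have "(\<lambda>i. Inl (T 0 - 1 - i)) ` {..<T 0} = Inl ` {..<T 0}"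
    proof (intro subset_antisym subsetI)
      fix x :: "nat + 'b" assume "x \<in> Inl ` {..<T 0}"
      then obtain n where "n < T 0" "x = Inl n" by blast
      then have "x = Inl (T 0 - 1 - (T 0 - 1 - n))" "T 0 - 1 - n < T 0" by simp_all
      then show "x \<in> (\<lambda>i. Inl (T 0 - 1 - i)) ` {..<T 0}" by blast
    qed auto
    finally show "pos ` graph_vertices ?a = indices"
      using bij_betw_imp_surj_on[OF head] by (simp add: indices_def)
  qed
  define \<phi> where "\<phi> = point \<circ> pos"
  have \<phi>_Inl: "\<phi> (Inl i) = spine (T 0 - 1 - i)" and \<phi>_Inr: "\<phi> (Inr x) = leaf T (head x)" for i x
    by (simp_all add: \<phi>_def pos_def point_def)
  have \<phi>: "bij_betw \<phi> (graph_vertices ?a) (point ` indices)"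
    unfolding \<phi>_def
    by (rule bij_betw_trans[OF pos]) (simp add: bij_betw_imageI inj_on_subset[OF inj_point])
  have mem: "\<phi> u \<in> point ` indices" if "u \<in> graph_vertices ?a" for u
    using bij_betw_apply[OF \<phi> that] .
  have weight: "self_int (point ` indices) (\<phi> u) = graph_weight ?a u"
    if u: "u \<in> graph_vertices ?a" for u
  proof (cases u)
    case (Inl i)
    then have "i < T 0" using u by (auto simp: graph_vertices_def len)
    then have "T 0 - 1 - i < T 0" "Suc (T 0 - 1 - i) = T 0 - i" by simp_all
    then show ?thesis using self_int_spine[of "T 0 - 1 - i"] \<open>i < T 0\<close>
      unfolding Inl \<phi>_Inl by (simp add: nth_dual_expansion)
  next
    case (Inr x)
    then show ?thesis by (simp add: \<phi>_Inr self_int_leaf)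
  qed
  have adj: "exc_adjacent (point ` indices) (\<phi> u) (\<phi> u') \<longleftrightarrow> graph_adjacent u u'"
    if u: "u \<in> graph_vertices ?a" and u': "u' \<in> graph_vertices ?a" for u u'
  proof -
    have attach: "spine (T 0 - 1 - i) = spine (T (head x) - 1) \<longleftrightarrow> i = fst x"
      if "i < T 0" "x \<in> new_vertices ?a" for i x
    proof -
      have "0 < T (head x)" "T (head x) \<le> T 0"
        using T_pos T_le_T0 head_less[OF that(2)] by blast+
      then show ?thesis using T_head[OF that(2)] that(1) by auto
    qed
    have consecutive: "T 0 - 1 - j \<noteq> 0 \<and> T 0 - 1 - i = T 0 - 1 - j - 1 \<longleftrightarrow> i = Suc j"
      if "i < T 0" "j < T 0" for i j using that by arith
    have adj: "exc_adjacent (point ` indices) (\<phi> u) (\<phi> u') \<longleftrightarrow>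
        \<phi> u' \<noteq> [] \<and> \<phi> u = butlast (\<phi> u') \<or> \<phi> u \<noteq> [] \<and> \<phi> u' = butlast (\<phi> u)"
      by (rule exc_adjacent_affine) (use point_affine mem[OF u] mem[OF u'] in auto)
    show ?thesis
    proof (cases u; cases u')
      fix i j assume ij: "u = Inl i" "u' = Inl j"
      then have "i < T 0" "j < T 0" using u u' by (auto simp: graph_vertices_def len)
      then show ?thesis using consecutive[of i j] consecutive[of j i]
        unfolding adj unfolding ij \<phi>_Inl butlast_spine spine_eq_iff spine_eq_Nil graph_adjacent.simps
        by blast
    next
      fix i x assume ix: "u = Inl i" "u' = Inr x"
      then have "i < T 0" "x \<in> new_vertices ?a" using u u' by (auto simp: graph_vertices_def len)
      then show ?thesis using attach[of i x] unfolding adj unfolding ix \<phi>_Inl \<phi>_Inr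
        by (cases x) simp
    next
      fix x i assume ix: "u = Inr x" "u' = Inl i"
      then have "i < T 0" "x \<in> new_vertices ?a" using u u' by (auto simp: graph_vertices_def len)
      then show ?thesis using attach[of i x] unfolding adj unfolding ix \<phi>_Inl \<phi>_Inr
        by (cases x) auto
    next
      fix x x' assume xx: "u = Inr x" "u' = Inr x'"
      then show ?thesis unfolding adj unfolding xx \<phi>_Inr by (cases x; cases x') simp
    qed
  qed
  have meets: "exc_meets_branch (point ` indices) (\<phi> u) (curve i) \<longleftrightarrow> u = Inr (\<psi> i)"
    if u: "u \<in> graph_vertices ?a" and i: "i < k" for u i
  proof (cases u)
    case (Inl n)
    then show ?thesis by (simp add: exc_meets_curve[OF i] \<phi>_Inl)
  next
    case (Inr x)
    then have x: "x \<in> new_vertices ?a" using u by (auto simp: graph_vertices_def)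
    have "head x = i \<longleftrightarrow> x = \<psi> i"
      using \<psi>_head[OF x] bij_betw_inv_into_left[OF \<psi>, of i] i by (auto simp: head_def)
    then show ?thesis by (simp add: exc_meets_curve[OF i] Inr \<phi>_Inr)
  qed
  have length: "decoration ! i = card (geodesic ?a (\<psi> i))" if "i < k" for i
    using card_geodesic[of "\<psi> i" ?a "T i"] fst[OF that] T_le_T0[OF that] that by (simp add: len)
  have order: "intersection_mult (curve i) (curve j) = card (geodesic ?a (\<psi> i) \<inter> geodesic ?a (\<psi> j))"
    if ij: "i < k" "j < k" "i \<noteq> j" for i j
  proof -
    have "\<psi> i \<noteq> \<psi> j" using bij_betw_imp_inj_on[OF \<psi>] ij by (auto simp: inj_on_def)
    then show ?thesis
      using card_geodesic_Int[of "\<psi> i" ?a "T i" "\<psi> j" "T j"] fst ij T_le_T0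
        intersection_mult_curve(2)[OF ij] by (simp add: len)
  qed
  show ?thesis
    unfolding cyclic_quotient_germ_def Let_def blown_up_points_germ length_germ
    by (intro exI[of _ ?a] exI[of _ \<phi>] exI[of _ \<psi>] conjI ballI allI impI)
      (use assms \<phi> \<psi> weight adj meets length order in \<open>simp_all only: nth_germ\<close>)
qed

end

section \<open>Incidences of the wiring diagram and of the infinitely near points\<close>

lemma wires_blowup_diagram: "wires (blowup_diagram k) = [1..<Suc k]"
proof (induction k rule: blowup_diagram.induct)
  case (3 r)
  then show ?case by (cases "blowup_diagram (Suc r)") (simp add: Let_def)
qed simp_all

lemma marks_blowup_diagram: "marks (blowup_diagram k) = map (\<lambda>i. {i}) [2..<Suc k]"
proof (induction k rule: blowup_diagram.induct)
  case (3 r)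
  then show ?case using wires_blowup_diagram[of "Suc r"]
    by (cases "blowup_diagram (Suc r)") (simp add: Let_def numeral_2_eq_2)
qed simp_all

lemma twist_eq:
  "twist m W = Wiring (wires W)
     (marks W @ concat (map (\<lambda>j. replicate (m ! j) (set (take (Suc j) (wires W)))) [0..<length m]))"
proof -
  have "fold (twist_step m) ss (Wiring ws ms) =
      Wiring ws (ms @ concat (map (\<lambda>s. replicate (m ! (s - 1)) (set (take s ws))) ss))" for ss ws ms
    by (induction ss arbitrary: ms) simp_all
  from this[of "[1..<Suc (length m)]" "wires W" "marks W"] show ?thesis
    by (simp add: twist_def comp_def del: upt_Suc flip: map_Suc_upt)
qed

text \<open>
  The free point that is missing on the first wire after the blowups is supplied by one of the
  twists on a single wire.
\<close>

lemma mset_marks_twist_blowup: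
  assumes "length m = k" and m: "\<And>j. j < k \<Longrightarrow> m ! j = (if j = 0 then 1 else 0) + d j" and "0 < k"
  shows "mset (marks (twist m (blowup_diagram k))) =
    image_mset (\<lambda>j. {Suc j}) (mset_set {..<k}) + (\<Sum>j<k. replicate_mset (d j) (Suc ` {..j}))"
proof -
  have take: "set (take (Suc j) [1..<Suc k]) = Suc ` {..j}" if "j < k" for j
    using that by (simp add: take_upt del: upt_Suc) (auto simp: image_Suc_lessThan atMost_atLeast0 simp flip: lessThan_Suc_atMost)
  have "mset (marks (twist m (blowup_diagram k))) = mset (map (\<lambda>i. {i}) [2..<Suc k]) +
      (\<Sum>j\<leftarrow>[0..<k]. replicate_mset (m ! j) (set (take (Suc j) [1..<Suc k])))"
    unfolding twist_eq marks_blowup_diagram wires_blowup_diagram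
    by (simp add: mset_concat comp_def assms(1) del: upt_Suc)
  also have "map (\<lambda>j. replicate_mset (m ! j) (set (take (Suc j) [1..<Suc k]))) [0..<k] =
      map (\<lambda>j. replicate_mset (m ! j) (Suc ` {..j})) [0..<k]"
    by (rule map_cong[OF refl]) (use take in \<open>simp del: upt_Suc\<close>)
  also have "(\<Sum>j\<leftarrow>[0..<k]. replicate_mset (m ! j) (Suc ` {..j})) =
      (\<Sum>j<k. replicate_mset (m ! j) (Suc ` {..j}))"
    by (simp add: interv_sum_list_conv_sum_set_nat atLeast0LessThan)
  also have "\<dots> = (\<Sum>j<k. (if j = 0 then {#{1}#} else {#}) + replicate_mset (d j) (Suc ` {..j}))"
    by (rule sum.cong) (simp_all add: m)
  also have "\<dots> = {#{1}#} + (\<Sum>j<k. replicate_mset (d j) (Suc ` {..j}))"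
    using \<open>0 < k\<close> by (simp add: sum.distrib)
  also have "mset (map (\<lambda>i. {i}) [2..<Suc k]) + ({#{1}#} + (\<Sum>j<k. replicate_mset (d j) (Suc ` {..j}))) =
      mset (map (\<lambda>i. {i}) [1..<Suc k]) + (\<Sum>j<k. replicate_mset (d j) (Suc ` {..j}))"
    using \<open>0 < k\<close> by (simp add: upt_conv_Cons numeral_2_eq_2 del: upt_Suc)
  also have "mset (map (\<lambda>i. {i}) [1..<Suc k]) = image_mset (\<lambda>j. {Suc j}) (mset_set {..<k})"
    by (simp add: comp_def lessThan_atLeast0 multiset.map_comp del: upt_Suc flip: map_Suc_upt)
  finally show ?thesis .
qed

lemma levels_Suc: "j < length b \<Longrightarrow> levels b j = (b ! j - 2) + levels b (Suc j)"
  by (simp add: levels_def flip: Cons_nth_drop_Suc)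

text \<open>
  The level drops by \<open>b ! j - 1\<close> after the last entry and by \<open>b ! j - 2\<close> after any other. Subtracting
  \<open>(1, 2, \<dots>, 2, 1)\<close> from \<open>b\<close> gives the same numbers, except that the first is larger by one.
\<close>

lemma twist_multiplicity:
  assumes "b \<noteq> []" "\<forall>x\<in>set b. 2 \<le> x" "j < length b"
  shows "map2 (-) b (std_tuple (length b)) ! j = (if j = 0 then 1 else 0) +
    (levels b j - (if Suc j < length b then levels b (Suc j) else 0))"
proof -
  have bj: "2 \<le> b ! j" using assms by simp
  have last: "levels b (length b) = 1" by (simp add: levels_def)
  have d: "levels b j - (if Suc j < length b then levels b (Suc j) else 0) =
      (b ! j - 2) + (if Suc j < length b then 0 else 1)"
    using levels_Suc[OF assms(3)] last assms(3) by (cases "Suc j = length b") auto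
  \<comment> \<open>For a single entry the tuple \<open>(1, 2, \<dots>, 2, 1)\<close> degenerates to \<open>(0)\<close>.\<close>
  consider "length b = 1" | r where "length b = Suc (Suc r)"
    using assms(1) by (cases b rule: list.exhaust; cases "tl b") auto
  then show ?thesis
  proof cases
    case 1
    then show ?thesis unfolding d using assms(3) bj by simp
  next
    case 2
    have len: "length (std_tuple (length b)) = length b" unfolding 2 std_tuple_eq by simp
    have "map2 (-) b (std_tuple (length b)) ! j = b ! j - std_tuple (length b) ! j"
      using assms(3) len by simp
    also have "std_tuple (length b) ! j = (if j = 0 \<or> Suc j = length b then 1 else 2)"
      using assms(3) unfolding 2 std_tuple_eq by (auto simp: nth_Cons nth_append split: nat.splits)
    finally show ?thesis unfolding d using assms(3) bj 2 by auto
  qed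
qed

context staircase
begin

lemma finite_indices: "finite indices"
  by (simp add: indices_def)

text \<open>
  For \<open>T (j + 1) \<le> n < T j\<close> the condition \<open>n < T i\<close> means \<open>i \<le> j\<close>. The spine is the union of
  these blocks, the block of the last branch being the one at the origin.
\<close>

lemma spine_incidences:
  "image_mset (\<lambda>n. {i. i < k \<and> n < T i}) (mset_set {..<T 0}) =
    (\<Sum>j<k. replicate_mset (T j - (if Suc j < k then T (Suc j) else 0)) {..j})"
proof -
  let ?f = "\<lambda>n. {i. i < k \<and> n < T i}"
  define U where "U j = (if j < k then T j else 0)" for j
  have "image_mset ?f (mset_set {..<U r}) = (\<Sum>j=r..<k. replicate_mset (U j - U (Suc j)) {..j})"
    if "r \<le> k" for r
    using that
  proof (induction r rule: inc_induct)
    case base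
    show ?case by (simp add: U_def)
  next
    case (step r)
    have le: "U (Suc r) \<le> U r" using step.hyps T_antimono[of r "Suc r"] by (simp add: U_def)
    \<comment> \<open>The branches \<open>0, \<dots>, r\<close> are those that reach the points of this block of the spine.\<close>
    have block: "?f n = {..r}" if n: "n \<in> {U (Suc r)..<U r}" for n
    proof (rule Set.set_eqI)
      fix i
      show "i \<in> ?f n \<longleftrightarrow> i \<in> {..r}"
      proof (cases "i \<le> r")
        case True
        then have "i < k" "T r \<le> T i" using step.hyps T_antimono by auto
        then show ?thesis using True n step.hyps by (simp add: U_def)
      next
        case False
        then have "T i \<le> U (Suc r)" if "i < k" using that T_antimono[of "Suc r" i] by (simp add: U_def)
        then show ?thesis using False n by auto
      qed
    qed
    have "mset_set {..<U r} = mset_set {..<U (Suc r)} + mset_set {U (Suc r)..<U r}"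
      using le by (subst mset_set_Union[symmetric]) (auto simp: ivl_disj_un)
    moreover have "image_mset ?f (mset_set {U (Suc r)..<U r}) =
        image_mset (\<lambda>_. {..r}) (mset_set {U (Suc r)..<U r})"
      by (rule image_mset_cong) (simp add: block)
    ultimately show ?case
      using step by (simp add: image_mset_const_eq sum.atLeast_Suc_lessThan)
  qed
  from this[of 0] show ?thesis using k_pos by (simp add: U_def atLeast0LessThan)
qed

lemma mset_through:
  "image_mset (\<lambda>P. Suc ` {i. i < k \<and> on_branch P (curve i)}) (mset_set (point ` indices)) =
    image_mset (\<lambda>j. {Suc j}) (mset_set {..<k}) +
    (\<Sum>j<k. replicate_mset (T j - (if Suc j < k then T (Suc j) else 0)) (Suc ` {..j}))"
proof -
  have through: "{i. i < k \<and> on_branch (point x) (curve i)} = through x" if "x \<in> indices" for x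
    using that on_branch_point[OF _ that] by (auto simp: through_def indices_def)
  have "image_mset (\<lambda>P. Suc ` {i. i < k \<and> on_branch P (curve i)}) (mset_set (point ` indices)) =
      image_mset (\<lambda>x. Suc ` {i. i < k \<and> on_branch (point x) (curve i)}) (mset_set indices)"
  proof -
    have "mset_set (point ` indices) = image_mset point (mset_set indices)"
      by (rule image_mset_mset_set[symmetric]) (rule inj_on_subset[OF inj_point], simp)
    then show ?thesis by (simp add: multiset.map_comp comp_def)
  qed
  also have "\<dots> = image_mset (\<lambda>x. Suc ` through x) (mset_set indices)"
    by (rule image_mset_cong) (simp add: through finite_indices)
  also have "mset_set indices = image_mset Inl (mset_set {..<T 0}) + image_mset Inr (mset_set {..<k})"
    unfolding indices_def by (subst mset_set_Union) (auto simp: image_mset_mset_set)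
  also have "image_mset (\<lambda>x. Suc ` through x) \<dots> =
      image_mset ((`) Suc) (image_mset (\<lambda>n. {i. i < k \<and> n < T i}) (mset_set {..<T 0})) +
      image_mset (\<lambda>j. {Suc j}) (mset_set {..<k})"
    by (simp add: through_def multiset.map_comp comp_def)
  also have "image_mset ((`) Suc) (image_mset (\<lambda>n. {i. i < k \<and> n < T i}) (mset_set {..<T 0})) =
      (\<Sum>j<k. replicate_mset (T j - (if Suc j < k then T (Suc j) else 0)) (Suc ` {..j}))"
  proof -
    have "image_mset f (\<Sum>j<n. replicate_mset (g j) (h j)) = (\<Sum>j<n. replicate_mset (g j) (f (h j)))"
      for f :: "nat set \<Rightarrow> nat set" and g h and n :: nat
      by (induction n) simp_all
    then show ?thesis unfolding spine_incidences .
  qed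
  finally show ?thesis by simp
qed

end

lemma mset_marks_diagram:
  assumes "b \<noteq> []" "\<forall>x\<in>set b. 2 \<le> x" and k: "k = length b"
    and m: "m = map2 (-) b (std_tuple k)"
  shows "mset (marks (twist m (blowup_diagram k))) =
    image_mset (\<lambda>P. Suc ` {i. i < k \<and> on_branch P (staircase.curve (levels b) i)})
      (mset_set (staircase.point (levels b) ` staircase.indices k (levels b)))"
proof -
  interpret staircase k "levels b" unfolding k by (rule staircase_levels[OF assms(1)])
  have len: "length (std_tuple k) = k"
  proof -
    consider "k = 1" | r where "k = Suc (Suc r)" using k_pos by (cases k; cases "k - 1") auto
    then show ?thesis by cases (simp_all add: std_tuple_eq)
  qed
  have "length m = k" using len k by (simp add: m)
  then show ?thesis
    unfolding mset_through
    by (rule mset_marks_twist_blowup) (use twist_multiplicity[OF assms(1,2)] m k k_pos in auto)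
qed

text \<open>
  Equality of the multisets of columns provides the permutation of the columns. The rows
  already correspond, wire \<open>i + 1\<close> to branch \<open>i\<close>.
\<close>

lemma combinatorially_equivalent_if_same_incidences:
  assumes ext: "extends_diagram W \<rho> F pts"
    and ws: "wires W = [1..<Suc k]"
    and ms: "mset (marks W) = image_mset (\<lambda>P. Suc ` {i. i < k \<and> R P i}) (mset_set S)"
    and "finite S" and \<beta>: "bij_betw \<beta> S M"
    and inc: "\<And>P i. P \<in> S \<Longrightarrow> i < k \<Longrightarrow> \<beta> P \<in> D i \<longleftrightarrow> R P i"
    and ps: "distinct ps" "set ps = M"
  shows "combinatorially_equivalent
    (incidence_matrix (map (\<lambda>w. graph_disk \<rho> (F w)) (wires W)) pts)
    (incidence_matrix (map D [0..<k]) ps)"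
proof -
  have pts: "length pts = length (marks W)"
  proof -
    obtain xs where "draws W (-\<rho>) \<rho> (\<lambda>w x. Re (F w (of_real x))) xs" "map fst pts = map of_real xs"
      using ext unfolding extends_diagram_def by blast
    then show ?thesis unfolding draws_def by (metis length_map)
  qed
  define \<alpha> where "\<alpha> = inv_into S \<beta>"
  have \<alpha>: "bij_betw \<alpha> M S" unfolding \<alpha>_def by (rule bij_betw_inv_into[OF \<beta>])
  let ?through = "\<lambda>P. Suc ` {i. i < k \<and> R P i}"
  have "mset (map \<alpha> ps) = mset_set S"
    using ps \<alpha> by (metis bij_betw_def distinct_map mset_set_set set_map)
  then have "image_mset \<alpha> (mset ps) = mset_set S" by simp
  then have "mset (marks W) = mset (map (?through \<circ> \<alpha>) ps)"
    unfolding ms mset_map by (metis multiset.map_comp)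
  then obtain \<tau> where \<tau>: "\<tau> permutes {..<length (map (?through \<circ> \<alpha>) ps)}"
    and perm: "permute_list \<tau> (map (?through \<circ> \<alpha>) ps) = marks W"
    by (rule mset_eq_permutation)
  have len: "length (marks W) = length ps" using arg_cong[OF perm, of length] by simp
  have nth: "marks W ! j = ?through (\<alpha> (ps ! \<tau> j))" if j: "j < length ps" for j
  proof -
    have "\<tau> j < length ps" using permutes_in_image[OF \<tau>, of j] j by simp
    then show ?thesis
      unfolding perm[symmetric] using permute_list_nth[OF \<tau>, of j] j by simp
  qed
  let ?A = "incidence_matrix (map (\<lambda>w. graph_disk \<rho> (F w)) (wires W)) pts"
  let ?B = "incidence_matrix (map D [0..<k]) ps"
  have dim: "dim_row ?A = k" "dim_col ?A = length ps" "dim_row ?B = k" "dim_col ?B = length ps"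
    using ws pts len by (simp_all add: incidence_matrix_def)
  have entry: "?A $$ (i, j) = ?B $$ (i, \<tau> j)" if i: "i < k" and j: "j < length ps" for i j
  proof -
    have \<tau>j: "\<tau> j < length ps" using permutes_in_image[OF \<tau>, of j] j by simp
    then have M: "ps ! \<tau> j \<in> M" using ps(2) nth_mem by blast
    then have S: "\<alpha> (ps ! \<tau> j) \<in> S" and \<beta>\<alpha>: "\<beta> (\<alpha> (ps ! \<tau> j)) = ps ! \<tau> j"
      using bij_betw_apply[OF \<alpha>] bij_betw_inv_into_right[OF \<beta>] by (auto simp: \<alpha>_def)
    have w: "wires W ! i = Suc i" "i < length (wires W)" using i ws by (simp_all del: upt_Suc)
    have "pts ! j \<in> graph_disk \<rho> (F (Suc i)) \<longleftrightarrow> Suc i \<in> marks W ! j"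
      using ext j i ws pts len unfolding extends_diagram_def by (simp del: upt_Suc)
    also have "\<dots> \<longleftrightarrow> R (\<alpha> (ps ! \<tau> j)) i" unfolding nth[OF j] using i by auto
    also have "\<dots> \<longleftrightarrow> ps ! \<tau> j \<in> D i" using inc[OF S i] \<beta>\<alpha> by simp
    finally show ?thesis
      using i j \<tau>j w pts len by (simp add: incidence_matrix_def)
  qed
  show ?thesis
    unfolding combinatorially_equivalent_def dim
    by (intro conjI exI[of _ id] exI[of _ \<tau>] refl)
      (use \<tau> entry in \<open>simp_all add: permutes_id\<close>)
qed

section \<open>The Scott deformation\<close>

lemma fps_expansion_poly:
  "fps_expansion (poly p) z = fps_of_poly (p \<circ>\<^sub>p [:z, 1:])"
proof (rule fps_expansion_unique_complex)
  show "(\<lambda>x. poly p (z + x)) has_fps_expansion fps_expansion (poly p) z"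
  proof (rule analytic_at_imp_has_fps_expansion)
    have "poly p holomorphic_on UNIV"
      unfolding holomorphic_on_def field_differentiable_def
      using poly_DERIV has_field_derivative_at_within by blast
    then show "poly p analytic_on {z}"
      using analytic_at by blast
  qed
  have "eval_fps (fps_of_poly (p \<circ>\<^sub>p [:z, 1:])) has_fps_expansion fps_of_poly (p \<circ>\<^sub>p [:z, 1:])"
    by (rule eval_fps_has_fps_expansion) simp
  moreover have "eval_fps (fps_of_poly (p \<circ>\<^sub>p [:z, 1:])) = (\<lambda>x. poly p (z + x))"
    by (rule ext) (simp add: poly_pcompose)
  ultimately show "(\<lambda>x. poly p (z + x)) has_fps_expansion fps_of_poly (p \<circ>\<^sub>p [:z, 1:])"
    by simp
qed

lemma branch_at_graph:
  "branch_at (\<lambda>t. (t, poly p t)) z = (fps_X, fps_of_poly (p \<circ>\<^sub>p [:z, 1:]) - fps_const (poly p z))"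
proof -
  have "poly [:0, 1:] = (\<lambda>t :: complex. t)" by auto
  then have "fps_expansion (\<lambda>t. t) z = fps_of_poly ([:0, 1:] \<circ>\<^sub>p [:z, 1:])"
    using fps_expansion_poly[of "[:0, 1:]" z] by metis
  then have "fps_expansion (\<lambda>t. t) z - fps_const z = fps_X"
    by (simp add: pcompose_pCons fps_of_poly_linear)
  then show ?thesis by (simp add: branch_at_def fps_expansion_poly)
qed

lemma smooth_branch_graph: "smooth_branch (branch_at (\<lambda>t. (t, poly p t)) z)"
proof -
  have "fps_conv_radius (fps_of_poly (p \<circ>\<^sub>p [:z, 1:]) - fps_const (poly p z)) > 0"
    using fps_conv_radius_diff[of "fps_of_poly (p \<circ>\<^sub>p [:z, 1:])" "fps_const (poly p z)"] by simp
  then show ?thesis by (simp add: branch_at_graph smooth_branch_def)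
qed

lemma pullback_equation_poly_graphs:
  assumes "poly p z = poly p' z"
  shows "pullback_equation (branch_at (\<lambda>t. (t, poly p t)) z) (branch_at (\<lambda>t. (t, poly p' t)) z) =
    fps_of_poly ((p - p') \<circ>\<^sub>p [:z, 1:])"
  unfolding branch_at_graph
  by (subst pullback_equation_graph)
    (use assms in \<open>simp_all add: pcompose_diff fps_of_poly_diff\<close>)

lemma tangent_dir_poly_graph:
  "tangent_dir (branch_at (\<lambda>t. (t, poly p t)) z) = Some (coeff (p \<circ>\<^sub>p [:z, 1:]) 1)"
  by (simp add: branch_at_graph tangent_dir_def)

text \<open>
  The order of vanishing at \<open>z\<close> counts the linear factors with root \<open>z\<close>; a cofactor without a zero
  at \<open>z\<close> does not contribute.
\<close>

lemma subdegree_shifted_linear_factors: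
  fixes r :: "complex poly"
  assumes "finite A" "poly r z \<noteq> 0"
  shows "fps_of_poly ((r * (\<Prod>n\<in>A. [:- x n, 1:])) \<circ>\<^sub>p [:z, 1:]) \<noteq> 0 \<and>
    subdegree (fps_of_poly ((r * (\<Prod>n\<in>A. [:- x n, 1:])) \<circ>\<^sub>p [:z, 1:])) = card {n \<in> A. x n = z}"
  using assms(1)
proof (induction A rule: finite_induct)
  case empty
  have nz: "fps_nth (fps_of_poly (r \<circ>\<^sub>p [:z, 1:])) 0 \<noteq> 0"
    using assms(2) by simp
  then have "fps_of_poly (r \<circ>\<^sub>p [:z, 1:]) \<noteq> 0" by (metis fps_zero_nth)
  moreover have "subdegree (fps_of_poly (r \<circ>\<^sub>p [:z, 1:])) = 0"
    by (rule subdegreeI[OF nz]) simp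
  ultimately show ?case by simp
next
  case (insert a A)
  let ?f = "fps_of_poly ((r * (\<Prod>n\<in>A. [:- x n, 1:])) \<circ>\<^sub>p [:z, 1:])"
  have split: "fps_of_poly ((r * (\<Prod>n\<in>insert a A. [:- x n, 1:])) \<circ>\<^sub>p [:z, 1:]) =
      fps_of_poly [:z - x a, 1:] * ?f"
  proof -
    have "r * (\<Prod>n\<in>insert a A. [:- x n, 1:]) = [:- x a, 1:] * (r * (\<Prod>n\<in>A. [:- x n, 1:]))"
      unfolding prod.insert[OF insert.hyps] by (rule mult.left_commute)
    moreover have "[:- x a, 1:] \<circ>\<^sub>p [:z, 1:] = [:z - x a, 1:]" by (simp add: pcompose_pCons)
    ultimately show ?thesis by (metis pcompose_mult fps_of_poly_mult)
  qed
  have lin: "fps_of_poly [:z - x a, 1:] \<noteq> 0"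
    "subdegree (fps_of_poly [:z - x a, 1:]) = (if x a = z then 1 else 0)"
    by (auto intro!: subdegreeI simp: fps_eq_iff intro: exI[of _ 1])
  have "{n \<in> insert a A. x n = z} = (if x a = z then {a} else {}) \<union> {n \<in> A. x n = z}" by auto
  then have "card {n \<in> insert a A. x n = z} = (if x a = z then 1 else 0) + card {n \<in> A. x n = z}"
    using insert.hyps by auto
  then show ?case unfolding split using insert.IH lin by (simp add: subdegree_mult)
qed

text \<open>
  Holomorphic in two variables, everywhere; unlike \<^const>\<open>holomorphic_germ2\<close>, this is closed
  under products without shrinking neighbourhoods.
\<close>

definition entire2 :: "(complex \<Rightarrow> complex \<Rightarrow> complex) \<Rightarrow> bool" where
  "entire2 f \<longleftrightarrow> (\<forall>z. \<exists>a b.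
     ((\<lambda>w. f (fst w) (snd w)) has_derivative (\<lambda>d. a * fst d + b * snd d)) (at z))"

lemma holomorphic_germ2_entire2: "entire2 f \<Longrightarrow> holomorphic_germ2 f"
  unfolding holomorphic_germ2_def entire2_def case_prod_beta by (intro exI[of _ UNIV]) auto

lemma entire2_const: "entire2 (\<lambda>s t. c)"
  unfolding entire2_def by (intro allI exI[of _ 0]) simp

lemma entire2_fst: "entire2 (\<lambda>s t. s)"
  unfolding entire2_def
  by (intro allI exI[of _ 1] exI[of _ 0]) (auto intro!: derivative_eq_intros)

lemma entire2_snd: "entire2 (\<lambda>s t. t)"
  unfolding entire2_def
  by (intro allI exI[of _ 0] exI[of _ 1]) (auto intro!: derivative_eq_intros)

lemma entire2_diff:
  assumes "entire2 f" "entire2 g"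
  shows "entire2 (\<lambda>s t. f s t - g s t)"
  unfolding entire2_def
proof
  fix z
  obtain a b c d where "((\<lambda>w. f (fst w) (snd w)) has_derivative (\<lambda>d. a * fst d + b * snd d)) (at z)"
    "((\<lambda>w. g (fst w) (snd w)) has_derivative (\<lambda>e. c * fst e + d * snd e)) (at z)"
    using assms unfolding entire2_def by meson
  from has_derivative_diff[OF this]
  have "((\<lambda>w. f (fst w) (snd w) - g (fst w) (snd w)) has_derivative
      (\<lambda>e. (a - c) * fst e + (b - d) * snd e)) (at z)"
    by (simp add: algebra_simps)
  then show "\<exists>a b. ((\<lambda>w. f (fst w) (snd w) - g (fst w) (snd w)) has_derivative
      (\<lambda>e. a * fst e + b * snd e)) (at z)"
    by blast
qed

lemma entire2_mult:
  assumes "entire2 f" "entire2 g"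
  shows "entire2 (\<lambda>s t. f s t * g s t)"
  unfolding entire2_def
proof
  fix z
  obtain a b c d where "((\<lambda>w. f (fst w) (snd w)) has_derivative (\<lambda>d. a * fst d + b * snd d)) (at z)"
    "((\<lambda>w. g (fst w) (snd w)) has_derivative (\<lambda>e. c * fst e + d * snd e)) (at z)"
    using assms unfolding entire2_def by meson
  from has_derivative_mult[OF this]
  have "((\<lambda>w. f (fst w) (snd w) * g (fst w) (snd w)) has_derivative
      (\<lambda>e. (f (fst z) (snd z) * c + a * g (fst z) (snd z)) * fst e +
      (f (fst z) (snd z) * d + b * g (fst z) (snd z)) * snd e)) (at z)"
    by (simp add: algebra_simps)
  then show "\<exists>a b. ((\<lambda>w. f (fst w) (snd w) * g (fst w) (snd w)) has_derivative
      (\<lambda>e. a * fst e + b * snd e)) (at z)"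
    by blast
qed

lemma entire2_prod:
  assumes "\<And>n. n \<in> A \<Longrightarrow> entire2 (f n)"
  shows "entire2 (\<lambda>s t. \<Prod>n\<in>A. f n s t)"
proof (cases "finite A")
  case True
  then show ?thesis using assms
    by (induction A rule: finite_induct) (simp_all add: entire2_const entire2_mult)
qed (simp add: entire2_const)

context staircase
begin

text \<open>
  Since \<open>n\<close> starts at \<open>1\<close>, the abscissa \<open>0\<close> is left for the free marked point of each branch.
\<close>

definition ordinate :: "nat \<Rightarrow> complex \<Rightarrow> complex poly" where
  "ordinate i s = Polynomial.smult (of_nat (Suc i)) (\<Prod>n=1..T i. [:- (of_nat n * s), 1:])"

definition family :: "nat \<Rightarrow> complex \<Rightarrow> complex \<Rightarrow> complex \<times> complex" where
  "family i s = (\<lambda>t. (t, poly (ordinate i s) t))"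

definition position :: "complex \<Rightarrow> nat + nat \<Rightarrow> complex \<times> complex" where
  "position s = case_sum (\<lambda>n. (of_nat (Suc n) * s, 0)) (\<lambda>j. (0, poly (ordinate j s) 0))"

text \<open>
  The first bound makes a product of factors of absolute value below \<open>2 r\<close>, multiplied by a
  coefficient at most \<open>k\<close>, smaller than \<open>1\<close>; the second keeps all roots \<open>n s\<close> with \<open>n \<le> T 0\<close> in the
  ball of radius \<open>r\<close>.
\<close>

definition small :: "real \<Rightarrow> complex \<Rightarrow> bool" where
  "small r s \<longleftrightarrow> 2 * real k * r \<le> 1 \<and> real (T 0) * norm s < r"

text \<open>
  All assertions about the fibres are proved for small parameters in this sense.
\<close>

lemma eventually_small:
  assumes "\<And>r s. small r s \<Longrightarrow> s \<noteq> 0 \<Longrightarrow> Q r s"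
  shows "\<forall>\<^sub>F r in at_right 0. \<forall>\<^sub>F s in at 0. Q r s"
proof -
  have T0: "0 < T 0" using T_pos k_pos by blast
  have "\<forall>\<^sub>F s in at 0. Q r s" if r: "0 < r" "r < 1 / (2 * real k)" for r
    unfolding eventually_at
  proof (intro exI[of _ "r / real (T 0)"] conjI ballI impI)
    show "0 < r / real (T 0)" using r T0 by simp
    fix s :: complex assume "s \<noteq> 0 \<and> dist s 0 < r / real (T 0)"
    then have "small r s" "s \<noteq> 0"
      using r T0 k_pos by (simp_all add: small_def field_simps)
    then show "Q r s" by (rule assms)
  qed
  then show ?thesis
    unfolding eventually_at_right_field using k_pos
    by (intro exI[of _ "1 / (2 * real k)"]) simp
qed

lemma poly_ordinate: "poly (ordinate i s) t = of_nat (Suc i) * (\<Prod>n=1..T i. t - of_nat n * s)"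
  by (simp add: ordinate_def poly_prod)

lemma poly_ordinate_eq_0:
  "poly (ordinate i s) t = 0 \<longleftrightarrow> (\<exists>n\<in>{1..T i}. t = of_nat n * s)"
  unfolding poly_ordinate by (auto simp del: of_nat_Suc)

lemma small_in_ball:
  assumes "small r s" "n \<le> T 0"
  shows "norm (of_nat n * s) < r"
proof -
  have "norm (of_nat n * s) \<le> real (T 0) * norm s"
    using assms(2) by (simp add: norm_mult mult_right_mono)
  then show ?thesis using assms(1) by (simp add: small_def)
qed

text \<open>
  For \<open>i < j\<close> the roots of the branch \<open>j\<close> are roots of the branch \<open>i\<close>. The remaining factor is the
  constant \<open>i - j\<close> or, if \<open>i\<close> has further roots, a perturbation of the nonzero number \<open>- (j + 1)\<close>.
\<close>

lemma ordinate_diff: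
  assumes "small r s" "t \<in> ball 0 r" "i < j" "j < k"
  obtains c where "ordinate i s - ordinate j s = c * (\<Prod>n=1..T j. [:- (of_nat n * s), 1:])"
    and "poly c t \<noteq> 0"
proof
  let ?lin = "\<lambda>n. [:- (of_nat n * s), 1:]"
  define B where "B = {Suc (T j)..T i}"
  define c where "c = Polynomial.smult (of_nat (Suc i)) (\<Prod>n\<in>B. ?lin n) - [:of_nat (Suc j):]"
  have "T j \<le> T i" using T_antimono assms by simp
  then have "{1..T i} = B \<union> {1..T j}" "B \<inter> {1..T j} = {}" unfolding B_def by auto
  then have "(\<Prod>n=1..T i. ?lin n) = (\<Prod>n\<in>B. ?lin n) * (\<Prod>n=1..T j. ?lin n)"
    by (simp add: prod.union_disjoint B_def)
  then show "ordinate i s - ordinate j s = c * (\<Prod>n=1..T j. ?lin n)"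
    unfolding ordinate_def c_def by (simp add: algebra_simps)
  have r: "2 * r \<le> 1" "real k * (2 * r) \<le> 1" "0 < r"
  proof -
    show "real k * (2 * r) \<le> 1" using assms(1) by (simp add: small_def mult_ac)
    show "0 < r" using assms(2) by (simp add: order_le_less_trans[OF norm_ge_zero])
    then have "1 * (2 * r) \<le> real k * (2 * r)" using k_pos by (intro mult_right_mono) auto
    then show "2 * r \<le> 1" using \<open>real k * (2 * r) \<le> 1\<close> by simp
  qed
  show "poly c t \<noteq> 0"
  proof (cases "B = {}")
    case True
    then show ?thesis using assms(3) by (simp add: c_def)
  next
    case False
    then obtain n0 where n0: "n0 \<in> B" by blast
    have finite: "finite B" by (simp add: B_def)
    have factor: "norm (t - of_nat n * s) < 2 * r" if "n \<in> B" for n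
    proof -
      have "n \<le> T 0" using that T_le_T0[of i] assms(3,4) by (simp add: B_def)
      then have "norm (of_nat n * s) < r" by (rule small_in_ball[OF assms(1)])
      then show ?thesis using norm_triangle_ineq4[of t "of_nat n * s"] assms(2) by simp
    qed
    have "norm (\<Prod>n\<in>B. t - of_nat n * s) = norm (t - of_nat n0 * s) * (\<Prod>n\<in>B - {n0}. norm (t - of_nat n * s))"
      unfolding prod.remove[OF finite n0] norm_mult prod_norm[symmetric] ..
    also have "\<dots> \<le> norm (t - of_nat n0 * s) * 1"
    proof (rule mult_left_mono)
      show "(\<Prod>n\<in>B - {n0}. norm (t - of_nat n * s)) \<le> 1"
        by (rule prod_le_1) (use factor r(1) in fastforce)
    qed simp
    also have "\<dots> < 2 * r" using factor[OF n0] by simp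
    finally have prod: "norm (\<Prod>n\<in>B. t - of_nat n * s) < 2 * r" .
    have "norm (of_nat (Suc i) * (\<Prod>n\<in>B. t - of_nat n * s)) \<le> real k * norm (\<Prod>n\<in>B. t - of_nat n * s)"
      unfolding norm_mult norm_of_nat using assms(3,4) by (intro mult_right_mono) auto
    also have "\<dots> < real k * (2 * r)" using prod k_pos by simp
    also have "\<dots> \<le> norm (of_nat (Suc j) :: complex)" using r(2) unfolding norm_of_nat by simp
    finally show ?thesis by (auto simp: c_def poly_prod simp del: of_nat_Suc)
  qed
qed

lemma ordinates_meet:
  assumes "small r s" "t \<in> ball 0 r" "i < j" "j < k"
  shows "poly (ordinate i s) t = poly (ordinate j s) t \<longleftrightarrow> (\<exists>n\<in>{1..T j}. t = of_nat n * s)"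
proof -
  obtain c where c: "ordinate i s - ordinate j s = c * (\<Prod>n=1..T j. [:- (of_nat n * s), 1:])"
    "poly c t \<noteq> 0" by (rule ordinate_diff[OF assms])
  have "poly (ordinate i s) t = poly (ordinate j s) t \<longleftrightarrow> poly (ordinate i s - ordinate j s) t = 0" by simp
  also have "\<dots> \<longleftrightarrow> (\<exists>n\<in>{1..T j}. t = of_nat n * s)"
    unfolding c(1) using c(2) by (simp add: poly_prod)
  finally show ?thesis .
qed

text \<open>
  For \<open>s = 0\<close> all roots coincide and the multiplicity is \<open>T j\<close>; for \<open>s \<noteq> 0\<close> it is \<open>1\<close>. The common
  formula makes it possible to compute \<^const>\<open>total_delta\<close> for all small \<open>s\<close> at once.
\<close>

lemma intersection_mult_family:
  assumes "small r s" "t \<in> ball 0 r" "i < j" "j < k"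
    and "poly (ordinate i s) t = poly (ordinate j s) t"
  shows "subdegree (fps_of_poly ((ordinate i s - ordinate j s) \<circ>\<^sub>p [:t, 1:])) =
      card {n \<in> {1..T j}. of_nat n * s = t}"
    and "intersection_mult (branch_at (family i s) t) (branch_at (family j s) t) =
      card {n \<in> {1..T j}. of_nat n * s = t}"
proof -
  obtain c where c: "ordinate i s - ordinate j s = c * (\<Prod>n=1..T j. [:- (of_nat n * s), 1:])"
    "poly c t \<noteq> 0" by (rule ordinate_diff[OF assms(1-4)])
  show sub: "subdegree (fps_of_poly ((ordinate i s - ordinate j s) \<circ>\<^sub>p [:t, 1:])) =
      card {n \<in> {1..T j}. of_nat n * s = t}"
    unfolding c(1) using subdegree_shifted_linear_factors[OF _ c(2), of "{1..T j}" "\<lambda>n. of_nat n * s"]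
    by simp
  show "intersection_mult (branch_at (family i s) t) (branch_at (family j s) t) =
      card {n \<in> {1..T j}. of_nat n * s = t}"
    unfolding intersection_mult_def family_def pullback_equation_poly_graphs[OF assms(5)] by (rule sub)
qed

text \<open>
  Two branches always meet in \<open>T j\<close> points counted with multiplicity, independently of \<open>s\<close>: this is
  \<open>\<delta>\<close>-constancy.
\<close>

lemma total_delta_family:
  assumes "small r s"
  shows "total_delta k (\<lambda>i. family i s) r = (\<Sum>(i, j)\<in>{(i, j). i < j \<and> j < k}. T j)"
  unfolding total_delta_def
proof (rule sum.cong[OF refl], clarify)
  fix i j assume ij: "i < j" "j < k"
  let ?g = "\<lambda>n. of_nat n * s"
  let ?m = "\<lambda>(t, u). intersection_mult (branch_at (family i s) t) (branch_at (family j s) u)"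
  have "{(t, u). t \<in> ball 0 r \<and> u \<in> ball 0 r \<and> family i s t = family j s u} =
      (\<lambda>t. (t, t)) ` ?g ` {1..T j}"
  proof (intro subset_antisym subsetI)
    fix z assume "z \<in> {(t, u). t \<in> ball 0 r \<and> u \<in> ball 0 r \<and> family i s t = family j s u}"
    then obtain t where t: "z = (t, t)" "t \<in> ball 0 r" "poly (ordinate i s) t = poly (ordinate j s) t"
      by (auto simp: family_def)
    then obtain n where "n \<in> {1..T j}" "t = ?g n" using ordinates_meet[OF assms t(2) ij] by blast
    then show "z \<in> (\<lambda>t. (t, t)) ` ?g ` {1..T j}" using t(1) by blast
  next
    fix z assume "z \<in> (\<lambda>t. (t, t)) ` ?g ` {1..T j}"
    then obtain n where n: "n \<in> {1..T j}" "z = (?g n, ?g n)" by blast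
    have "n \<le> T 0" using n(1) T_le_T0[OF ij(2)] by simp
    then have ball: "?g n \<in> ball 0 r" using small_in_ball[OF assms] by simp
    then have "poly (ordinate i s) (?g n) = poly (ordinate j s) (?g n)"
      using ordinates_meet[OF assms ball ij] n(1) by blast
    then show "z \<in> {(t, u). t \<in> ball 0 r \<and> u \<in> ball 0 r \<and> family i s t = family j s u}"
      using ball n(2) by (simp add: family_def)
  qed
  then have "sum ?m {(t, u). t \<in> ball 0 r \<and> u \<in> ball 0 r \<and> family i s t = family j s u} =
      (\<Sum>t\<in>?g ` {1..T j}. intersection_mult (branch_at (family i s) t) (branch_at (family j s) t))"
    by (simp add: sum.reindex inj_on_def)
  also have "\<dots> = (\<Sum>t\<in>?g ` {1..T j}. card {n \<in> {1..T j}. ?g n = t})"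
  proof (rule sum.cong[OF refl])
    fix t assume "t \<in> ?g ` {1..T j}"
    then obtain n where n: "n \<in> {1..T j}" "t = ?g n" by blast
    have "n \<le> T 0" using n(1) T_le_T0[OF ij(2)] by simp
    then have ball: "t \<in> ball 0 r" using small_in_ball[OF assms] n(2) by simp
    then show "intersection_mult (branch_at (family i s) t) (branch_at (family j s) t) =
        card {n \<in> {1..T j}. ?g n = t}"
      using intersection_mult_family(2)[OF assms ball ij] ordinates_meet[OF assms ball ij] n by blast
  qed
  also have "\<dots> = card {1..T j}"
    using sum.image_gen[of "{1..T j}" "\<lambda>_. 1::nat" ?g] by simp
  finally show "sum ?m {(t, u). t \<in> ball 0 r \<and> u \<in> ball 0 r \<and> family i s t = family j s u} = T j"
    by simp
qed

text \<open>
  For \<open>s \<noteq> 0\<close> the roots are simple, hence the intersections are transversal.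
\<close>

lemma family_meets_family:
  assumes "small r s" "t \<in> ball 0 r" "i < k" "j < k" "i \<noteq> j"
    and "poly (ordinate i s) t = poly (ordinate j s) t"
  shows "poly (ordinate i s) t = 0"
    and "s \<noteq> 0 \<Longrightarrow> tangent_dir (branch_at (family i s) t) \<noteq> tangent_dir (branch_at (family j s) t)"
proof -
  have "poly (ordinate i s) t = 0 \<and>
      (s \<noteq> 0 \<longrightarrow> tangent_dir (branch_at (family i s) t) \<noteq> tangent_dir (branch_at (family j s) t))"
    if ij: "i < j" "j < k" and eq: "poly (ordinate i s) t = poly (ordinate j s) t" for i j
  proof
    obtain n where n: "n \<in> {1..T j}" "t = of_nat n * s"
      using ordinates_meet[OF assms(1,2) ij] eq by blast
    then show "poly (ordinate i s) t = 0" unfolding eq poly_ordinate_eq_0 by blast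
    show "s \<noteq> 0 \<longrightarrow> tangent_dir (branch_at (family i s) t) \<noteq> tangent_dir (branch_at (family j s) t)"
    proof
      let ?d = "(ordinate i s - ordinate j s) \<circ>\<^sub>p [:t, 1:]"
      assume "s \<noteq> 0"
      then have "{n \<in> {1..T j}. of_nat n * s = t} = {n}" using n by auto
      then have sub: "subdegree (fps_of_poly ?d) = 1"
        using intersection_mult_family(1)[OF assms(1,2) ij eq] by simp
      then have "fps_of_poly ?d \<noteq> 0" by (metis subdegree_0 zero_neq_one)
      then have "coeff ?d 1 \<noteq> 0" using nth_subdegree_nonzero[of "fps_of_poly ?d"] sub by simp
      then show "tangent_dir (branch_at (family i s) t) \<noteq> tangent_dir (branch_at (family j s) t)"
        unfolding family_def tangent_dir_poly_graph by (simp add: pcompose_diff)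
    qed
  qed
  from this[of i j] this[of j i] show "poly (ordinate i s) t = 0"
    and "s \<noteq> 0 \<Longrightarrow> tangent_dir (branch_at (family i s) t) \<noteq> tangent_dir (branch_at (family j s) t)"
    using assms(3-6) by (metis nat_neq_iff)+
qed

text \<open>
  The deformed branches pass through the marked points as the original branches pass through the
  infinitely near points. The free point of a branch is on no other branch, since branches meet only
  on the axis \<open>Y = 0\<close> and a branch has no root at \<open>0\<close>.
\<close>

lemma position_on_fibre:
  assumes "small r s" "s \<noteq> 0" "i < k" "x \<in> indices"
  shows "position s x \<in> fibre_branch family r s i \<longleftrightarrow> i \<in> through x"
proof (cases x)
  case (Inl n)
  then have "Suc n \<le> T 0" using assms(4) by (auto simp: indices_def)
  then have ball: "of_nat (Suc n) * s \<in> ball 0 r"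
    using small_in_ball[OF assms(1), of "Suc n"] by (simp del: of_nat_Suc)
  have "position s x \<in> fibre_branch family r s i \<longleftrightarrow> poly (ordinate i s) (of_nat (Suc n) * s) = 0"
    using ball unfolding Inl position_def fibre_branch_def family_def
    by (auto simp: image_iff simp del: of_nat_Suc)
  also have "\<dots> \<longleftrightarrow> n < T i"
    unfolding poly_ordinate_eq_0 using assms(2) by (auto simp del: of_nat_Suc)
  finally show ?thesis using assms(3) by (simp add: Inl through_def)
next
  case (Inr j)
  then have j: "j < k" using assms(4) by (auto simp: indices_def)
  have ball: "0 \<in> ball 0 r" using small_in_ball[OF assms(1), of 0] by simp
  have "position s x \<in> fibre_branch family r s i \<longleftrightarrow> poly (ordinate i s) 0 = poly (ordinate j s) 0"
    using ball unfolding Inr position_def fibre_branch_def family_def by (auto simp: image_iff)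
  also have "\<dots> \<longleftrightarrow> i = j"
  proof -
    have "poly (ordinate j s) 0 \<noteq> 0" using assms(2) by (auto simp: poly_ordinate_eq_0)
    then show ?thesis using family_meets_family(1)[OF assms(1) ball assms(3) j] by auto
  qed
  finally show ?thesis by (simp add: Inr through_def)
qed

lemma inj_on_position:
  assumes "small r s" "s \<noteq> 0"
  shows "inj_on (position s) indices"
proof (rule inj_onI)
  fix x y assume xy: "x \<in> indices" "y \<in> indices" "position s x = position s y"
  show "x = y"
  proof (cases x; cases y)
    fix i j assume ij: "x = Inr i" "y = Inr j"
    then have "j < k" using xy(2) by (auto simp: indices_def)
    then have "j \<in> through y \<longleftrightarrow> j \<in> through x"
      using position_on_fibre[OF assms] xy by metis
    then show ?thesis using ij by (simp add: through_def)
  qed (use xy(3) assms(2) in \<open>simp_all add: position_def del: of_nat_Suc\<close>)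
qed

text \<open>
  The marked points of a branch are its roots and its point over \<open>0\<close>, which are the zeros of a
  single holomorphic function that specializes to a multiple of \<open>t\<^bsup>T i + 1\<^esup>\<close>.
\<close>

lemma family_in_positions:
  assumes "small r s" "s \<noteq> 0" "i < k" "t \<in> ball 0 r"
  shows "family i s t \<in> position s ` indices \<longleftrightarrow> t * poly (ordinate i s) t = 0"
proof
  assume "family i s t \<in> position s ` indices"
  then obtain x where x: "x \<in> indices" "family i s t = position s x" by blast
  then show "t * poly (ordinate i s) t = 0"
    by (cases x) (auto simp: family_def position_def)
next
  assume "t * poly (ordinate i s) t = 0"
  then consider "t = 0" | n where "n \<in> {1..T i}" "t = of_nat n * s" "poly (ordinate i s) t = 0"
    using poly_ordinate_eq_0 by (metis mult_eq_0_iff)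
  then show "family i s t \<in> position s ` indices"
  proof cases
    case 1
    then have "family i s t = position s (Inr i)" by (simp add: family_def position_def)
    moreover have "Inr i \<in> indices" using assms(3) by (simp add: indices_def)
    ultimately show ?thesis by blast
  next
    case 2
    then have "family i s t = position s (Inl (n - 1))" by (simp add: family_def position_def)
    moreover have "Inl (n - 1) \<in> indices" using 2(1) T_le_T0[OF assms(3)] by (auto simp: indices_def)
    ultimately show ?thesis by blast
  qed
qed

lemma card_positions_on_fibre:
  assumes "small r s" "s \<noteq> 0" "i < k"
  shows "finite (position s ` indices \<inter> fibre_branch family r s i)"
    and "card (position s ` indices \<inter> fibre_branch family r s i) = Suc (T i)"
proof -
  show "finite (position s ` indices \<inter> fibre_branch family r s i)" using finite_indices by blast
  have "position s ` indices \<inter> fibre_branch family r s i = position s ` {x \<in> indices. i \<in> through x}"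
    using position_on_fibre[OF assms] by blast
  then have "card (position s ` indices \<inter> fibre_branch family r s i) = card {x \<in> indices. i \<in> through x}"
    using card_image[OF inj_on_subset[OF inj_on_position[OF assms(1,2)]]] by (metis (lifting) mem_Collect_eq subsetI)
  also have "{x \<in> indices. i \<in> through x} = insert (Inr i) (Inl ` {..<T i})"
    using assms(3) T_le_T0[OF assms(3)] by (auto simp: indices_def through_def)
  also have "card \<dots> = Suc (T i)" by (simp add: card_insert_if image_iff card_image)
  finally show "card (position s ` indices \<inter> fibre_branch family r s i) = Suc (T i)" .
qed

lemma entire2_ordinate: "entire2 (\<lambda>s t. poly (ordinate i s) t)"
  unfolding poly_ordinate
  by (intro entire2_mult entire2_const entire2_prod entire2_diff entire2_fst entire2_snd)

lemma ordinate_0: "ordinate i 0 = monom (of_nat (Suc i)) (T i)"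
  by (simp add: ordinate_def monom_altdef)

lemma family_0_branch_at:
  assumes "i < k"
  shows "branch_at (family i 0) 0 = curve i"
  unfolding family_def branch_at_graph ordinate_0 curve_def pcompose_idR fps_of_poly_monom
  using T_pos[OF assms] by (simp add: poly_monom)

lemma picture_deformation_family:
  "picture_deformation germ decoration family (\<lambda>s. position s ` indices)"
proof -
  have "holomorphic_germ2 (\<lambda>s t. fst (family i s t)) \<and> holomorphic_germ2 (\<lambda>s t. snd (family i s t)) \<and>
      family i 0 0 = (0, 0) \<and> branch_at (family i 0) 0 = germ ! i \<and>
      (\<exists>h. holomorphic_germ2 h \<and> fps_expansion (h 0) 0 \<noteq> 0 \<and>
         subdegree (fps_expansion (h 0) 0) = decoration ! i \<and>
         (\<forall>\<^sub>F r in at_right 0. \<forall>\<^sub>F s in at 0.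
            \<forall>t\<in>ball 0 r. family i s t \<in> position s ` indices \<longleftrightarrow> h s t = 0))" if i: "i < k" for i
  proof (intro conjI)
    show "holomorphic_germ2 (\<lambda>s t. fst (family i s t))"
      by (simp add: family_def holomorphic_germ2_entire2 entire2_snd)
    show "holomorphic_germ2 (\<lambda>s t. snd (family i s t))"
      by (simp add: family_def holomorphic_germ2_entire2 entire2_ordinate)
    show "family i 0 0 = (0, 0)" using T_pos[OF i] by (simp add: family_def ordinate_0 poly_monom)
    show "branch_at (family i 0) 0 = germ ! i" using family_0_branch_at i by simp
    let ?h = "\<lambda>s t. t * poly (ordinate i s) t"
    have "?h 0 = poly (monom (of_nat (Suc i)) (Suc (T i)))"
      by (simp add: ordinate_0 poly_monom fun_eq_iff del: of_nat_Suc)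
    then have h: "fps_expansion (?h 0) 0 = fps_const (of_nat (Suc i)) * fps_X ^ Suc (T i)"
      by (simp add: fps_expansion_poly pcompose_idR fps_of_poly_monom del: of_nat_Suc power_Suc)
    have nz: "fps_nth (fps_const (of_nat (Suc i)) * fps_X ^ Suc (T i) :: complex fps) (Suc (T i)) \<noteq> 0"
      by (simp del: of_nat_Suc power_Suc)
    show "\<exists>h. holomorphic_germ2 h \<and> fps_expansion (h 0) 0 \<noteq> 0 \<and>
         subdegree (fps_expansion (h 0) 0) = decoration ! i \<and>
         (\<forall>\<^sub>F r in at_right 0. \<forall>\<^sub>F s in at 0.
            \<forall>t\<in>ball 0 r. family i s t \<in> position s ` indices \<longleftrightarrow> h s t = 0)"
    proof (intro exI[of _ ?h] conjI)
      show "holomorphic_germ2 ?h"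
        by (intro holomorphic_germ2_entire2 entire2_mult entire2_snd entire2_ordinate)
      show "fps_expansion (?h 0) 0 \<noteq> 0" unfolding h using nz by (metis fps_zero_nth)
      have "subdegree (fps_const (of_nat (Suc i)) * fps_X ^ Suc (T i) :: complex fps) = Suc (T i)"
        by (rule subdegreeI[OF nz]) (simp del: of_nat_Suc power_Suc)
      then show "subdegree (fps_expansion (?h 0) 0) = decoration ! i" unfolding h using i by simp
      show "\<forall>\<^sub>F r in at_right 0. \<forall>\<^sub>F s in at 0.
          \<forall>t\<in>ball 0 r. family i s t \<in> position s ` indices \<longleftrightarrow> ?h s t = 0"
        by (rule eventually_small) (use family_in_positions[OF _ _ i] in blast)
    qed
  qed
  moreover have "\<forall>\<^sub>F r in at_right 0. \<forall>\<^sub>F s in at 0.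
      (\<forall>i<k. inj_on (family i s) (ball 0 r) \<and>
         (\<forall>t\<in>ball 0 r. smooth_branch (branch_at (family i s) t))) \<and>
      (\<forall>i<k. \<forall>j<k. \<forall>t\<in>ball 0 r. \<forall>u\<in>ball 0 r.
         i \<noteq> j \<and> family i s t = family j s u \<longrightarrow>
           tangent_dir (branch_at (family i s) t) \<noteq> tangent_dir (branch_at (family j s) u) \<and>
           family i s t \<in> position s ` indices) \<and>
      position s ` indices \<subseteq> (\<Union>i<k. fibre_branch family r s i) \<and>
      (\<forall>i<k. finite (position s ` indices \<inter> fibre_branch family r s i) \<and>
         card (position s ` indices \<inter> fibre_branch family r s i) = decoration ! i) \<and>
      total_delta k (\<lambda>i. family i s) r = total_delta k (\<lambda>i. family i 0) r"
  proof (rule eventually_small, intro conjI)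
    fix r s assume small: "small r s" and s: "s \<noteq> 0"
    show "\<forall>i<k. inj_on (family i s) (ball 0 r) \<and>
        (\<forall>t\<in>ball 0 r. smooth_branch (branch_at (family i s) t))"
      unfolding family_def using smooth_branch_graph by (auto simp: inj_on_def)
    show "\<forall>i<k. \<forall>j<k. \<forall>t\<in>ball 0 r. \<forall>u\<in>ball 0 r. i \<noteq> j \<and> family i s t = family j s u \<longrightarrow>
        tangent_dir (branch_at (family i s) t) \<noteq> tangent_dir (branch_at (family j s) u) \<and>
        family i s t \<in> position s ` indices"
    proof (intro allI impI ballI)
      fix i j t u
      assume i: "i < k" and j: "j < k" and t: "t \<in> ball 0 r" and "i \<noteq> j \<and> family i s t = family j s u"
      then have ij: "i \<noteq> j" and u: "u = t" and eq: "poly (ordinate i s) t = poly (ordinate j s) t"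
        by (auto simp: family_def)
      show "tangent_dir (branch_at (family i s) t) \<noteq> tangent_dir (branch_at (family j s) u) \<and>
          family i s t \<in> position s ` indices"
        using family_meets_family[OF small t i j ij eq] family_in_positions[OF small s i t] s u by simp
    qed
    show "position s ` indices \<subseteq> (\<Union>i<k. fibre_branch family r s i)"
    proof
      fix z assume "z \<in> position s ` indices"
      then obtain x where x: "x \<in> indices" "z = position s x" by blast
      have "\<exists>i<k. i \<in> through x"
        using x(1) k_pos by (auto simp: indices_def through_def)
      then show "z \<in> (\<Union>i<k. fibre_branch family r s i)"
        using position_on_fibre[OF small s _ x(1)] x(2) by blast
    qed
    show "\<forall>i<k. finite (position s ` indices \<inter> fibre_branch family r s i) \<and>
        card (position s ` indices \<inter> fibre_branch family r s i) = decoration ! i"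
      using card_positions_on_fibre[OF small s] by simp
    have "small r 0" using small by (simp add: small_def) (metis k_pos less_le_trans mult_nonneg_nonneg norm_ge_zero of_nat_0_le_iff order_le_less_trans)
    then show "total_delta k (\<lambda>i. family i s) r = total_delta k (\<lambda>i. family i 0) r"
      using total_delta_family small by simp
  qed
  ultimately show ?thesis unfolding picture_deformation_def length_germ by blast
qed

lemma scott_deformation_family:
  "scott_deformation germ decoration family (\<lambda>s. position s ` indices)"
  unfolding scott_deformation_def
proof (intro conjI)
  show "picture_deformation germ decoration family (\<lambda>s. position s ` indices)"
    by (rule picture_deformation_family)
  show "\<forall>\<^sub>F r in at_right 0. \<forall>\<^sub>F s in at 0.
      \<exists>\<beta>. bij_betw \<beta> (blown_up_points germ decoration) (position s ` indices) \<and>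
        (\<forall>P\<in>blown_up_points germ decoration. \<forall>i<length germ.
           \<beta> P \<in> fibre_branch family r s i \<longleftrightarrow> on_branch P (germ ! i))"
  proof (rule eventually_small)
    fix r s assume small: "small r s" and s: "s \<noteq> 0"
    define \<alpha> where "\<alpha> = inv_into indices point"
    have point: "bij_betw point indices (point ` indices)"
      by (rule bij_betw_imageI[OF inj_on_subset[OF inj_point]]) simp_all
    have \<alpha>_point: "\<alpha> (point x) = x" if "x \<in> indices" for x
      unfolding \<alpha>_def by (rule bij_betw_inv_into_left[OF point that])
    have "bij_betw (position s \<circ> \<alpha>) (point ` indices) (position s ` indices)"
      unfolding \<alpha>_def
      by (rule bij_betw_trans[OF bij_betw_inv_into[OF point] bij_betw_imageI[OF inj_on_position[OF small s] refl]])
    moreover have "(position s \<circ> \<alpha>) P \<in> fibre_branch family r s i \<longleftrightarrow> on_branch P (germ ! i)"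
      if P: "P \<in> point ` indices" and i: "i < k" for P i
    proof -
      obtain x where x: "x \<in> indices" "P = point x" using P by blast
      then show ?thesis
        using \<alpha>_point[OF x(1)] position_on_fibre[OF small s i x(1)] on_branch_point[OF i x(1)] i by simp
    qed
    ultimately show "\<exists>\<beta>. bij_betw \<beta> (blown_up_points germ decoration) (position s ` indices) \<and>
        (\<forall>P\<in>blown_up_points germ decoration. \<forall>i<length germ.
           \<beta> P \<in> fibre_branch family r s i \<longleftrightarrow> on_branch P (germ ! i))"
      unfolding blown_up_points_germ length_germ by blast
  qed
qed

end

section \<open>Comparison of the diagram with the Scott deformation\<close>

theorem corollary5:
  fixes p q k :: nat and b n m :: "nat list"
  assumes "coprime p q" and "1 \<le> q" and "q < p"
    and "is_hj_expansion b (of_nat p / of_nat (p - q))"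
    and "k = length b" and "n = std_tuple k" and "m = map2 (-) b n"
  shows "\<exists>C l. decorated_germ C l \<and> represents_cyclic_quotient p q C l \<and>
    cyclic_quotient_germ p q C l \<and>
    (\<exists>\<Gamma> M. scott_deformation C l \<Gamma> M) \<and>
    (\<forall>\<rho> F pts \<Gamma> M.
       extends_diagram (twist m (blowup_diagram k)) \<rho> F pts \<and> scott_deformation C l \<Gamma> M \<longrightarrow>
       (\<forall>\<^sub>F r in at_right 0. \<forall>\<^sub>F s in at 0. \<forall>ps. distinct ps \<and> set ps = M s \<longrightarrow>
          combinatorially_equivalent
            (incidence_matrix
               (map (\<lambda>w. graph_disk \<rho> (F w)) (wires (twist m (blowup_diagram k)))) pts)
            (incidence_matrix (map (fibre_branch \<Gamma> r s) [0..<length C]) ps)))"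
proof -
  have b: "b \<noteq> []" "\<forall>x\<in>set b. 2 \<le> x" using assms(4) by (auto simp: is_hj_expansion_def)
  interpret staircase k "levels b" unfolding assms(5) by (rule staircase_levels[OF b(1)])
  let ?W = "twist m (blowup_diagram k)" and ?S = "blown_up_points germ decoration"
  have germ: "cyclic_quotient_germ p q germ decoration"
    by (rule cyclic_quotient_germ_germ) (use is_hj_expansion_dual[OF assms(4,2,3)] assms(5) in simp)
  have wires: "wires ?W = [1..<Suc k]" by (simp add: twist_eq wires_blowup_diagram del: upt_Suc)
  have marks: "mset (marks ?W) =
      image_mset (\<lambda>P. Suc ` {i. i < k \<and> on_branch P (curve i)}) (mset_set ?S)"
    unfolding blown_up_points_germ using mset_marks_diagram[OF b assms(5)] assms(6,7) by simp
  have fin: "finite ?S" unfolding blown_up_points_germ using finite_indices by simp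
  have "\<forall>\<^sub>F r in at_right 0. \<forall>\<^sub>F s in at 0. \<forall>ps. distinct ps \<and> set ps = M s \<longrightarrow>
      combinatorially_equivalent
        (incidence_matrix (map (\<lambda>w. graph_disk \<rho> (F w)) (wires ?W)) pts)
        (incidence_matrix (map (fibre_branch \<Gamma> r s) [0..<length germ]) ps)"
    if ext: "extends_diagram ?W \<rho> F pts" and scott: "scott_deformation germ decoration \<Gamma> M"
    for \<rho> F pts \<Gamma> M
  proof -
    have "\<forall>\<^sub>F r in at_right 0. \<forall>\<^sub>F s in at 0. \<exists>\<beta>. bij_betw \<beta> ?S (M s) \<and>
        (\<forall>P\<in>?S. \<forall>i<length germ. \<beta> P \<in> fibre_branch \<Gamma> r s i \<longleftrightarrow> on_branch P (germ ! i))"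
      using scott unfolding scott_deformation_def by blast
    then show ?thesis
    proof (elim eventually_mono, intro allI impI)
      fix r s ps
      assume "\<exists>\<beta>. bij_betw \<beta> ?S (M s) \<and>
          (\<forall>P\<in>?S. \<forall>i<length germ. \<beta> P \<in> fibre_branch \<Gamma> r s i \<longleftrightarrow> on_branch P (germ ! i))"
        and ps: "distinct ps \<and> set ps = M s"
      then obtain \<beta> where \<beta>: "bij_betw \<beta> ?S (M s)"
        and inc: "\<And>P i. P \<in> ?S \<Longrightarrow> i < k \<Longrightarrow> \<beta> P \<in> fibre_branch \<Gamma> r s i \<longleftrightarrow> on_branch P (curve i)"
        by auto
      show "combinatorially_equivalent
          (incidence_matrix (map (\<lambda>w. graph_disk \<rho> (F w)) (wires ?W)) pts)
          (incidence_matrix (map (fibre_branch \<Gamma> r s) [0..<length germ]) ps)"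
        unfolding length_germ
        by (rule combinatorially_equivalent_if_same_incidences[OF ext wires marks fin \<beta> inc])
          (use ps in simp_all)
    qed
  qed
  then show ?thesis
    using decorated_germ_germ cyclic_quotient_germ_represents[OF germ] germ scott_deformation_family
    by blast
qed

end
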